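(* Let $n\ge 3$ and let $s\in\{+,-\}^{\mathcal C}$ be a sign pattern on the set $\mathcal C$ of chords of the $n$-gon. Then $\mathcal{M}_{0,n}(\mathbb{R}_s)$ is non-empty if and only if $s$ is consistent; equivalently, every consistent sign pattern is realizable. Moreover, if $\mathcal{M}_{0,n}(\mathbb{R}_s)\neq\emptyset$, then $\mathcal{M}_{0,n}(\mathbb{R}_s)$ is connected and is isomorphic, as a semi-algebraic set, to $\mathcal{M}_{0,n}(\mathbb{R}_{>0})$.
   Context: $\mathcal{M}_{0,n}$ is the moduli space of $n$ distinct labeled points $z_1,\dots,z_n$ on $\mathbb{P}^1$ modulo $\mathrm{PGL}_2$; $\mathcal{M}_{0,n}(\mathbb{R})$ denotes its real points ($n$ distinct points on $\mathbb{P}^1(\mathbb{R})$ modulo $\mathrm{PGL}_2(\mathbb{R})$). The cross-ratio is $[ij|kl]=\frac{(z_i-z_k)(z_j-z_l)}{(z_i-z_l)(z_j-z_k)}$. Labels are taken cyclically modulo $n$ (so $n+1=1$). A chord of the $n$-gon is an unordered pair $\{i,j\}$ of labels with $j\notin\{i-1,i,i+1\}$; there are $\binom n2-n$ chords. The dihedral coordinates are $u_{ij}=[i,\,i+1\,|\,j+1,\,j]$ for chords $ij$ (note $u_{ij}=u_{ji}$); they give a closed embedding of $\mathcal{M}_{0,n}$ into $(\mathbb{C}^* )^{\binom n2-n}$, and real points map into $(\mathbb{R}^* )^{\binom n2-n}$. A sign pattern $s$ assigns $+$ or $-$ to each chord; $\mathbb{R}_s$ is the corresponding open orthant of $\mathbb{R}^{\binom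 n2-n}$ and $\mathcal{M}_{0,n}(\mathbb{R}_s)=\mathcal{M}_{0,n}(\mathbb{R})\cap\mathbb{R}_s$ (points whose coordinates $u_{ij}$ have signs $s(u_{ij})$). $s$ is realizable if $\mathcal{M}_{0,n}(\mathbb{R}_s)\ne\emptyset$. $\mathcal{M}_{0,n}(\mathbb{R}_{>0})$ is the set where all $u_{ij}>0$ (equivalently, $z_1,\dots,z_n$ lie in this cyclic order on $\mathbb{P}^1(\mathbb{R})$). Extended $u$-relations: for every partition of the labels $1,\dots,n$ into four non-empty cyclic intervals $A=(a,\dots,b-1)$, $B=(b,\dots,c-1)$, $C=(c,\dots,d-1)$, $D=(d,\dots,a-1)$, one has $\prod_{i\in A,j\in C}u_{ij}+\prod_{k\in B,l\in D}u_{kl}=1$ on $\mathcal{M}_{0,n}$. A sign pattern $s$ is consistent if it does not contradict any extended $u$-relation, i.e. for no such partition are both monomials negative, where the sign of a monomial under $s$ is the product of the signs $s(u_{ij})$ of its factors. *)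

theory Defs
  imports "HOL-Analysis.Analysis" "HOL-Library.Disjoint_Sets"
begin

section \<open>The real projective line and cross-ratios\<close>

text \<open>Points of the real projective line are the lines through the origin of the plane; the point
  with affine coordinate \<open>x / y\<close> is the line spanned by \<open>(x, y)\<close>.\<close>

definition proj_line :: "(real^2) set set" where
  "proj_line = {span {v} | v. v \<noteq> 0}"

definition rep :: "(real^2) set \<Rightarrow> real^2" where
  "rep L = (SOME v. v \<in> L \<and> v \<noteq> 0)"

definition bracket :: "real^2 \<Rightarrow> real^2 \<Rightarrow> real" where
  "bracket v w = v$1 * w$2 - w$1 * v$2"

text \<open>With \<open>z\<^sub>i = x\<^sub>i / y\<^sub>i\<close> one has \<open>z\<^sub>i - z\<^sub>k = bracket (x\<^sub>i, y\<^sub>i) (x\<^sub>k, y\<^sub>k) / (y\<^sub>i * y\<^sub>k)\<close>, and the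
  factors \<open>y\<close> cancel in \<open>[ij|kl] = (z\<^sub>i - z\<^sub>k) (z\<^sub>j - z\<^sub>l) / ((z\<^sub>i - z\<^sub>l) (z\<^sub>j - z\<^sub>k))\<close>. The homogeneous form
  below is therefore the usual cross-ratio, and it also covers points at infinity.\<close>

definition cross_ratio ::
  "(real^2) set \<Rightarrow> (real^2) set \<Rightarrow> (real^2) set \<Rightarrow> (real^2) set \<Rightarrow> real" where
  "cross_ratio p q r t =
     (bracket (rep p) (rep r) * bracket (rep q) (rep t)) /
     (bracket (rep p) (rep t) * bracket (rep q) (rep r))"

lemma rep_span:
  assumes "v \<noteq> 0"
  obtains c where "c \<noteq> 0" "rep (span {v}) = c *\<^sub>R v"
proof -
  have "\<exists>w. w \<in> span {v} \<and> w \<noteq> 0"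
    using assms span_base by blast
  then have *: "rep (span {v}) \<in> span {v} \<and> rep (span {v}) \<noteq> 0"
    unfolding rep_def by (rule someI_ex)
  then obtain c where "rep (span {v}) = c *\<^sub>R v"
    by (auto simp: span_singleton)
  with * that show thesis by auto
qed

lemma cross_ratio_span:
  assumes "a \<noteq> 0" "b \<noteq> 0" "c \<noteq> 0" "d \<noteq> 0"
  shows "cross_ratio (span {a}) (span {b}) (span {c}) (span {d}) =
    (bracket a c * bracket b d) / (bracket a d * bracket b c)"
proof -
  obtain \<alpha> where \<alpha>: "\<alpha> \<noteq> 0" "rep (span {a}) = \<alpha> *\<^sub>R a" using rep_span assms(1) .
  obtain \<beta> where \<beta>: "\<beta> \<noteq> 0" "rep (span {b}) = \<beta> *\<^sub>R b" using rep_span assms(2) .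
  obtain \<gamma> where \<gamma>: "\<gamma> \<noteq> 0" "rep (span {c}) = \<gamma> *\<^sub>R c" using rep_span assms(3) .
  obtain \<delta> where \<delta>: "\<delta> \<noteq> 0" "rep (span {d}) = \<delta> *\<^sub>R d" using rep_span assms(4) .
  have bs: "bracket (x *\<^sub>R v) (y *\<^sub>R w) = (x * y) * bracket v w" for x y v w
    by (simp add: bracket_def algebra_simps)
  have "cross_ratio (span {a}) (span {b}) (span {c}) (span {d}) =
    ((\<alpha> * \<beta> * \<gamma> * \<delta>) * (bracket a c * bracket b d)) /
    ((\<alpha> * \<beta> * \<gamma> * \<delta>) * (bracket a d * bracket b c))"
    unfolding cross_ratio_def \<alpha> \<beta> \<gamma> \<delta> bs by (simp add: mult_ac)
  also have "\<dots> = (bracket a c * bracket b d) / (bracket a d * bracket b c)"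
    using \<alpha>(1) \<beta>(1) \<gamma>(1) \<delta>(1) by simp
  finally show ?thesis .
qed

section \<open>The moduli space of \<open>n\<close> distinct points and its dihedral coordinates\<close>

text \<open>The labels are \<open>0, \<dots>, n - 1\<close>, read modulo \<open>n\<close>.\<close>

definition configurations :: "nat \<Rightarrow> (nat \<Rightarrow> (real^2) set) set" where
  "configurations n = {z \<in> {..<n} \<rightarrow>\<^sub>E proj_line. inj_on z {..<n}}"

text \<open>Scalar matrices fix every line, so the orbits of the projective linear group are those of the
  group of invertible matrices.\<close>

definition pgl_equiv :: "nat \<Rightarrow> ((nat \<Rightarrow> (real^2) set) \<times> (nat \<Rightarrow> (real^2) set)) set" where
  "pgl_equiv n = {(z, w). z \<in> configurations n \<and> w \<in> configurations n \<and>
     (\<exists>g :: real^2^2. invertible g \<and> (\<forall>i<n. w i = (\<lambda>v. g *v v) ` z i))}"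

definition M0 :: "nat \<Rightarrow> (nat \<Rightarrow> (real^2) set) set set" where
  "M0 n = configurations n // pgl_equiv n"

definition chords :: "nat \<Rightarrow> nat set set" where
  "chords n = {{i, j} | i j. i < n \<and> j < n \<and>
     j \<noteq> i \<and> j \<noteq> (i + 1) mod n \<and> i \<noteq> (j + 1) mod n}"

text \<open>The coordinate of the chord \<open>{i, j}\<close> does not depend on which end is called \<open>i\<close>; see
  \<open>dihedral_coord_doubleton\<close>.\<close>

definition dihedral_coord :: "nat \<Rightarrow> (nat \<Rightarrow> (real^2) set) \<Rightarrow> nat set \<Rightarrow> real" where
  "dihedral_coord n z c = (let i = Min c; j = Max c in
     cross_ratio (z i) (z ((i + 1) mod n)) (z ((j + 1) mod n)) (z j))"

lemma cross_ratio_flip: "cross_ratio p q r t = cross_ratio t r q p"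
  by (simp add: cross_ratio_def bracket_def field_simps)

lemma dihedral_coord_doubleton:
  "dihedral_coord n z {i, j} = cross_ratio (z i) (z ((i + 1) mod n)) (z ((j + 1) mod n)) (z j)"
proof (cases "i \<le> j")
  case True
  then show ?thesis by (simp add: dihedral_coord_def min_def max_def)
next
  case False
  then show ?thesis
    using cross_ratio_flip by (simp add: dihedral_coord_def min_def max_def)
qed

text \<open>The value on a class does not depend on the representative; see \<open>dihedral_map_class\<close>.\<close>

definition dihedral_map :: "nat \<Rightarrow> (nat \<Rightarrow> (real^2) set) set \<Rightarrow> nat set \<Rightarrow> real" where
  "dihedral_map n X = (\<lambda>c\<in>chords n. dihedral_coord n (SOME z. z \<in> X) c)"

lemma equiv_pgl_equiv: "equiv (configurations n) (pgl_equiv n)"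
proof (rule equivI)
  show "pgl_equiv n \<subseteq> configurations n \<times> configurations n"
    by (auto simp: pgl_equiv_def)
  show "refl_on (configurations n) (pgl_equiv n)"
  proof (rule refl_onI)
    fix z assume "z \<in> configurations n"
    moreover have "invertible (mat 1 :: real^2^2)" by (simp add: invertible_def)
    ultimately show "(z, z) \<in> pgl_equiv n"
      unfolding pgl_equiv_def by (auto intro!: exI[of _ "mat 1"])
  qed
  show "sym (pgl_equiv n)"
  proof (rule symI)
    fix z w assume "(z, w) \<in> pgl_equiv n"
    then obtain g :: "real^2^2" where g: "z \<in> configurations n" "w \<in> configurations n"
      "invertible g" "\<And>i. i < n \<Longrightarrow> w i = (\<lambda>v. g *v v) ` z i"
      by (auto simp: pgl_equiv_def)
    obtain h where h: "g ** h = mat 1" "h ** g = mat 1"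
      using g(3) by (auto simp: invertible_def)
    have "invertible h" using h by (auto simp: invertible_def)
    moreover have "z i = (\<lambda>v. h *v v) ` w i" if "i < n" for i
      using that h by (simp add: g(4) image_image matrix_vector_mul_assoc)
    ultimately show "(w, z) \<in> pgl_equiv n" using g by (auto simp: pgl_equiv_def)
  qed
  show "trans (pgl_equiv n)"
  proof (rule transI)
    fix x y z assume "(x, y) \<in> pgl_equiv n" "(y, z) \<in> pgl_equiv n"
    then obtain g h :: "real^2^2" where g: "x \<in> configurations n" "z \<in> configurations n"
      "invertible g" "\<And>i. i < n \<Longrightarrow> y i = (\<lambda>v. g *v v) ` x i"
      "invertible h" "\<And>i. i < n \<Longrightarrow> z i = (\<lambda>v. h *v v) ` y i"
      by (auto simp: pgl_equiv_def)
    have "invertible (h ** g)" using g by (simp add: invertible_mult)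
    moreover have "z i = (\<lambda>v. (h ** g) *v v) ` x i" if "i < n" for i
      using that by (simp add: g image_image matrix_vector_mul_assoc)
    ultimately show "(x, z) \<in> pgl_equiv n" using g by (auto simp: pgl_equiv_def)
  qed
qed

lemma cross_ratio_invariant:
  fixes g :: "real^2^2"
  assumes "invertible g" "p \<in> proj_line" "q \<in> proj_line" "r \<in> proj_line" "t \<in> proj_line"
  shows "cross_ratio ((\<lambda>v. g *v v) ` p) ((\<lambda>v. g *v v) ` q) ((\<lambda>v. g *v v) ` r) ((\<lambda>v. g *v v) ` t) =
    cross_ratio p q r t"
proof -
  obtain a b c d where abcd: "p = span {a}" "q = span {b}" "r = span {c}" "t = span {d}"
    and nz: "a \<noteq> 0" "b \<noteq> 0" "c \<noteq> 0" "d \<noteq> 0"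
    using assms(2-) by (auto simp: proj_line_def)
  have im: "(\<lambda>v. g *v v) ` span {x} = span {g *v x}" for x
    using linear_span_image[OF matrix_vector_mul_linear[of g], of "{x}"] by simp
  have inj: "g *v x \<noteq> 0" if "x \<noteq> 0" for x
    using that assms(1) by (metis invertible_def matrix_left_invertible_ker)
  have det: "det g \<noteq> 0" using assms(1) by (simp add: invertible_det_nz)
  have br: "bracket (g *v x) (g *v y) = det g * bracket x y" for x y
    by (simp add: bracket_def det_2 matrix_vector_mult_def sum_2 algebra_simps)
  show ?thesis
    using det by (simp add: abcd im cross_ratio_span nz inj br)
qed

lemma dihedral_map_class:
  assumes "z \<in> configurations n"
  shows "dihedral_map n (pgl_equiv n `` {z}) = (\<lambda>c\<in>chords n. dihedral_coord n z c)"
proof -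
  define w where "w = (SOME w. w \<in> pgl_equiv n `` {z})"
  have "z \<in> pgl_equiv n `` {z}"
    using equiv_class_self[OF equiv_pgl_equiv assms] .
  then have "(z, w) \<in> pgl_equiv n"
    unfolding w_def by (metis Image_singleton_iff someI)
  then obtain g :: "real^2^2" where g: "invertible g" "\<And>i. i < n \<Longrightarrow> w i = (\<lambda>v. g *v v) ` z i"
    by (auto simp: pgl_equiv_def)
  have zp: "z i \<in> proj_line" if "i < n" for i
    using assms that by (auto simp: configurations_def)
  have "dihedral_coord n w c = dihedral_coord n z c" if "c \<in> chords n" for c
  proof -
    from that obtain i j where ij: "c = {i, j}" "i < n" "j < n" by (auto simp: chords_def)
    then show ?thesis
      by (simp add: dihedral_coord_doubleton g cross_ratio_invariant zp)
  qed
  then show ?thesis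
    unfolding dihedral_map_def w_def[symmetric] by (auto simp: restrict_def)
qed

section \<open>Sign patterns\<close>

text \<open>The signs \<open>+\<close> and \<open>-\<close> are the real numbers \<open>1\<close> and \<open>- 1\<close>. The moduli space is identified with its
  image under the dihedral embedding.\<close>

definition orthant :: "nat \<Rightarrow> (nat set \<Rightarrow> real) \<Rightarrow> (nat set \<Rightarrow> real) set" where
  "orthant n s = {u \<in> chords n \<rightarrow>\<^sub>E UNIV. \<forall>c\<in>chords n. sgn (u c) = s c}"

definition M0_signed :: "nat \<Rightarrow> (nat set \<Rightarrow> real) \<Rightarrow> (nat set \<Rightarrow> real) set" where
  "M0_signed n s = dihedral_map n ` M0 n \<inter> orthant n s"

definition M0_pos :: "nat \<Rightarrow> (nat set \<Rightarrow> real) set" where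
  "M0_pos n = {u \<in> dihedral_map n ` M0 n. \<forall>c\<in>chords n. u c > 0}"

definition realizable :: "nat \<Rightarrow> (nat set \<Rightarrow> real) \<Rightarrow> bool" where
  "realizable n s \<longleftrightarrow> M0_signed n s \<noteq> {}"

text \<open>The labels \<open>a, a + 1, \<dots>, b - 1\<close> modulo \<open>n\<close>, for \<open>a, b < n\<close>; empty if \<open>a = b\<close>.\<close>

definition cyc_interval :: "nat \<Rightarrow> nat \<Rightarrow> nat \<Rightarrow> nat set" where
  "cyc_interval n a b = {x. x < n \<and> (x + n - a) mod n < (b + n - a) mod n}"

text \<open>Distinctness is needed besides \<open>partition_on\<close>, which would admit \<open>A = C\<close> and \<open>B = D\<close>.\<close>

definition cyclic_partition ::
  "nat \<Rightarrow> nat set \<Rightarrow> nat set \<Rightarrow> nat set \<Rightarrow> nat set \<Rightarrow> bool" where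
  "cyclic_partition n A B C D \<longleftrightarrow>
     (\<exists>a<n. \<exists>b<n. \<exists>c<n. \<exists>d<n.
        A = cyc_interval n a b \<and> B = cyc_interval n b c \<and>
        C = cyc_interval n c d \<and> D = cyc_interval n d a) \<and>
     distinct [A, B, C, D] \<and> partition_on {..<n} {A, B, C, D}"

text \<open>Each partition carries the extended relation
  \<open>(\<Prod>i\<in>A. \<Prod>j\<in>C. u {i, j}) + (\<Prod>k\<in>B. \<Prod>l\<in>D. u {k, l}) = 1\<close>.\<close>

definition consistent :: "nat \<Rightarrow> (nat set \<Rightarrow> real) \<Rightarrow> bool" where
  "consistent n s \<longleftrightarrow>
     \<not> (\<exists>A B C D. cyclic_partition n A B C D \<and>
          (\<Prod>i\<in>A. \<Prod>j\<in>C. s {i, j}) = -1 \<and> (\<Prod>k\<in>B. \<Prod>l\<in>D. s {k, l}) = -1)"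

section \<open>Semi-algebraic sets\<close>

text \<open>The affine space with coordinates indexed by \<open>I\<close> is the set \<open>I \<rightarrow>\<^sub>E UNIV\<close> of extensional functions.\<close>

inductive_set poly_funs :: "'i set \<Rightarrow> (('i \<Rightarrow> real) \<Rightarrow> real) set" for I where
  const: "(\<lambda>x. r) \<in> poly_funs I"
| coord: "i \<in> I \<Longrightarrow> (\<lambda>x. x i) \<in> poly_funs I"
| add: "p \<in> poly_funs I \<Longrightarrow> q \<in> poly_funs I \<Longrightarrow> (\<lambda>x. p x + q x) \<in> poly_funs I"
| mult: "p \<in> poly_funs I \<Longrightarrow> q \<in> poly_funs I \<Longrightarrow> (\<lambda>x. p x * q x) \<in> poly_funs I"

inductive_set semialgebraic_sets :: "'i set \<Rightarrow> ('i \<Rightarrow> real) set set" for I where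
  pos: "p \<in> poly_funs I \<Longrightarrow> {x \<in> I \<rightarrow>\<^sub>E UNIV. p x > 0} \<in> semialgebraic_sets I"
| compl: "S \<in> semialgebraic_sets I \<Longrightarrow> (I \<rightarrow>\<^sub>E UNIV) - S \<in> semialgebraic_sets I"
| inter: "S \<in> semialgebraic_sets I \<Longrightarrow> T \<in> semialgebraic_sets I \<Longrightarrow> S \<inter> T \<in> semialgebraic_sets I"

text \<open>For \<open>x\<close> and \<open>y\<close> in the affine spaces over \<open>I\<close> and \<open>J\<close>, \<open>case_sum x y\<close> is the pair \<open>(x, y)\<close> as a
  point of the affine space over the disjoint union \<open>I <+> J\<close>.\<close>

definition semialgebraic_map ::
  "'i set \<Rightarrow> 'j set \<Rightarrow> ('i \<Rightarrow> real) set \<Rightarrow> (('i \<Rightarrow> real) \<Rightarrow> ('j \<Rightarrow> real)) \<Rightarrow> bool" where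
  "semialgebraic_map I J S f \<longleftrightarrow>
     f ` S \<subseteq> (J \<rightarrow>\<^sub>E UNIV) \<and> (\<lambda>x. case_sum x (f x)) ` S \<in> semialgebraic_sets (I <+> J)"

text \<open>Isomorphism of semi-algebraic sets is semi-algebraic homeomorphism. The inverse map is
  automatically semi-algebraic, its graph being the transposed one.\<close>

definition semialgebraic_isomorphic ::
  "'i set \<Rightarrow> 'j set \<Rightarrow> ('i \<Rightarrow> real) set \<Rightarrow> ('j \<Rightarrow> real) set \<Rightarrow> bool" where
  "semialgebraic_isomorphic I J S T \<longleftrightarrow>
     S \<in> semialgebraic_sets I \<and> T \<in> semialgebraic_sets J \<and>
     (\<exists>f. semialgebraic_map I J S f \<and>
          homeomorphic_map (subtopology (powertop_real I) S) (subtopology (powertop_real J) T) f)"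

end

theory Submission
  imports Defs
begin

text \<open>Put the last label at infinity. The dihedral coordinates \<open>u\<close> are then Laurent monomials in the
  differences \<open>z\<^sub>i - z\<^sub>j\<close>, and conversely the differences are, up to a common factor, Laurent monomials in
  \<open>u\<close>. This monomial correspondence makes sense for arbitrary non-zero values, so a sign pattern \<open>s\<close> is the
  same as a tournament on the finite labels up to reversal. The extended relations with a part ending at
  infinity say that a consistent \<open>s\<close> gives a tournament without cyclic triangles, that is a linear order.
  Hence the realizations of \<open>s\<close> are the images of the points \<open>z\<close> sorted by this order, a convex set, and
  permuting the labels (a map which is rational in \<open>u\<close>) identifies them with the positive part.\<close>

section \<open>Coordinates of antisymmetric brackets\<close>

text \<open>There is exactly one pair \<open>i < j <= M\<close> more than there are chords,
  \<open>(M + 1) M / 2\<close> against \<open>(M + 2) (M - 1) / 2\<close>. This accounts for the one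
  free factor, and for the fact that no relation on \<open>u\<close> is needed to pass back to a
  function \<open>h\<close> on pairs. The relations enter only when \<open>h\<close> has to be a
  family of differences: for a cut with fourth point at infinity the two monomials are
  \<open>h j k / h i k\<close> and \<open>h i j / h i k\<close>. Their sum is \<open>1\<close>
  exactly if \<open>h i k = h i j + h j k\<close>, and both are negative exactly for a cyclic
  triangle. The later part is shaped by the definition of semi-algebraic sets through polynomial
  inequalities and Boolean operations, without projections. Neither the image of the moduli space
  nor the graph of a relabelling may be described by a quantifier over representatives. The
  representative with \<open>z 0 = 0\<close> and \<open>z M = 1\<close> has entries polynomial in
  \<open>u\<close>, so it replaces the quantifier, and all equations are stated with denominators
  cleared.\<close>

definition cyc_ratio :: "nat \<Rightarrow> (nat \<Rightarrow> nat \<Rightarrow> real) \<Rightarrow> nat \<Rightarrow> nat \<Rightarrow> real" where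
  "cyc_ratio n b i j =
     (b i ((j + 1) mod n) * b ((i + 1) mod n) j) / (b i j * b ((i + 1) mod n) ((j + 1) mod n))"

lemma cyc_ratio_commute:
  assumes "\<And>i j. i < n \<Longrightarrow> j < n \<Longrightarrow> b j i = - b i j" "i < n" "j < n"
  shows "cyc_ratio n b i j = cyc_ratio n b j i"
proof -
  have "(i + 1) mod n < n" "(j + 1) mod n < n" using assms(2) by auto
  then have "b j i = - b i j" "b ((j + 1) mod n) i = - b i ((j + 1) mod n)"
    "b j ((i + 1) mod n) = - b ((i + 1) mod n) j"
    "b ((j + 1) mod n) ((i + 1) mod n) = - b ((i + 1) mod n) ((j + 1) mod n)"
    using assms by blast+
  then show ?thesis by (simp only: cyc_ratio_def minus_mult_minus mult.commute)
qed

text \<open>Each of the indices \<open>i\<close>, \<open>i + 1\<close>, \<open>j\<close>,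
  \<open>j + 1\<close> occurs once above and once below the fraction line, so the factors
  \<open>l\<close> cancel. This permits rescaling the vector on each line separately.\<close>

lemma cyc_ratio_rescale:
  assumes "\<And>i j. i < n \<Longrightarrow> j < n \<Longrightarrow> b' i j = l i * l j * b i j"
    and "\<And>i. i < n \<Longrightarrow> l i \<noteq> 0" "i < n" "j < n"
  shows "cyc_ratio n b' i j = cyc_ratio n b i j"
proof -
  let ?i = "(i + 1) mod n" and ?j = "(j + 1) mod n"
  have "?i < n" "?j < n" using assms(3) by auto
  then have "cyc_ratio n b' i j =
    ((l i * l j * l ?i * l ?j) * (b i ?j * b ?i j)) / ((l i * l j * l ?i * l ?j) * (b i j * b ?i ?j))"
    using assms by (simp add: cyc_ratio_def mult_ac)
  also have "\<dots> = cyc_ratio n b i j"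
    using assms(2)[OF \<open>i < n\<close>] assms(2)[OF \<open>j < n\<close>] assms(2)[OF \<open>?i < n\<close>] assms(2)[OF \<open>?j < n\<close>]
    by (simp add: cyc_ratio_def)
  finally show ?thesis .
qed

text \<open>The larger endpoint decides how infinity enters the coordinate: not at all, as the
  successor of \<open>M\<close>, or as an endpoint, whose successor is \<open>0\<close>. The pair
  \<open>{0, Suc M}\<close> is a side.\<close>

lemma chordsE:
  assumes "c \<in> chords (Suc (Suc M))"
  obtains (inner) i j where "c = {i, j}" "Suc i < j" "j < M"
  | (last) i where "c = {i, M}" "Suc i < M"
  | (infinity) i where "c = {i, Suc M}" "0 < i" "i < M"
proof -
  let ?n = "Suc (Suc M)"
  obtain p q where pq: "c = {p, q}" "p < ?n" "q < ?n" "p \<noteq> q" "q \<noteq> (p + 1) mod ?n" "p \<noteq> (q + 1) mod ?n"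
    using assms unfolding chords_def by auto
  define i j where "i = min p q" and "j = max p q"
  have ij: "c = {i, j}" "j < ?n" "i < j" using pq by (auto simp: i_def j_def min_def max_def)
  have "j \<noteq> Suc i" "\<not> (i = 0 \<and> j = Suc M)"
    using pq by (auto simp: i_def j_def min_def max_def split: if_splits)
  then consider "j < M" "Suc i < j" | "j = M" "Suc i < M" | "j = Suc M" "0 < i" "i < M"
    using ij by linarith
  then show thesis
    using that ij(1) by cases blast+
qed

lemma doubleton_in_chords_iff:
  assumes "i < j" "j \<le> Suc M"
  shows "{i, j} \<in> chords (Suc (Suc M)) \<longleftrightarrow> Suc i < j \<and> \<not> (i = 0 \<and> j = Suc M)"
proof
  assume "{i, j} \<in> chords (Suc (Suc M))"
  then show "Suc i < j \<and> \<not> (i = 0 \<and> j = Suc M)"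
    using assms by (elim chordsE) (auto simp: doubleton_eq_iff)
next
  assume *: "Suc i < j \<and> \<not> (i = 0 \<and> j = Suc M)"
  show "{i, j} \<in> chords (Suc (Suc M))"
    unfolding chords_def
    by (rule CollectI, rule exI[of _ i], rule exI[of _ j]) (use assms * in \<open>auto simp: mod_Suc\<close>)
qed

lemma finite_chords: "finite (chords n)"
proof (rule finite_subset)
  show "chords n \<subseteq> Pow {..<n}" by (auto simp: chords_def)
qed simp

text \<open>A function on the pairs \<open>i < j \<le> M\<close>, thought of as \<open>z\<^sub>i - z\<^sub>j\<close>, becomes an antisymmetric bracket on
  the labels \<open>0, \<dots>, M + 1\<close>, where the label \<open>M + 1\<close> is the point at infinity.\<close>

definition skew :: "nat \<Rightarrow> (nat \<Rightarrow> nat \<Rightarrow> real) \<Rightarrow> nat \<Rightarrow> nat \<Rightarrow> real" where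
  "skew M h i j = (if i = j then 0 else if j = Suc M then 1 else if i = Suc M then - 1
     else if i < j then h i j else - h j i)"

definition ratio_coords :: "nat \<Rightarrow> (nat \<Rightarrow> nat \<Rightarrow> real) \<Rightarrow> nat set \<Rightarrow> real" where
  "ratio_coords M h =
     (\<lambda>c\<in>chords (Suc (Suc M)). cyc_ratio (Suc (Suc M)) (skew M h) (Min c) (Max c))"

lemma skew_commute: "skew M h j i = - skew M h i j"
  by (auto simp: skew_def)

lemma skew_nonzero:
  assumes "\<And>i j. i < j \<Longrightarrow> j \<le> M \<Longrightarrow> h i j \<noteq> 0" "i < Suc (Suc M)" "j < Suc (Suc M)" "i \<noteq> j"
  shows "skew M h i j \<noteq> 0"
  using assms(2-4) assms(1)[of i j] assms(1)[of j i] by (auto simp: skew_def)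

lemma ratio_coords_doubleton:
  assumes "{i, j} \<in> chords (Suc (Suc M))"
  shows "ratio_coords M h {i, j} = cyc_ratio (Suc (Suc M)) (skew M h) i j"
proof -
  have "i < Suc (Suc M)" "j < Suc (Suc M)"
    using assms by (auto simp: chords_def doubleton_eq_iff)
  then have "cyc_ratio (Suc (Suc M)) (skew M h) j i = cyc_ratio (Suc (Suc M)) (skew M h) i j"
    by (intro cyc_ratio_commute skew_commute)
  then show ?thesis
    using assms by (cases "i \<le> j") (simp_all add: ratio_coords_def min_def max_def)
qed

lemma ratio_coords_inner:
  assumes "Suc i < j" "j < M"
  shows "ratio_coords M h {i, j} = (h i (Suc j) * h (Suc i) j) / (h i j * h (Suc i) (Suc j))"
proof -
  have "{i, j} \<in> chords (Suc (Suc M))" using assms by (simp add: doubleton_in_chords_iff)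
  then show ?thesis
    using assms by (simp add: ratio_coords_doubleton cyc_ratio_def skew_def)
qed

lemma ratio_coords_last:
  assumes "Suc i < M"
  shows "ratio_coords M h {i, M} = h (Suc i) M / h i M"
proof -
  have "{i, M} \<in> chords (Suc (Suc M))" using assms by (simp add: doubleton_in_chords_iff)
  then show ?thesis
    using assms by (simp add: ratio_coords_doubleton cyc_ratio_def skew_def)
qed

lemma ratio_coords_infinity:
  assumes "0 < i" "i < M"
  shows "ratio_coords M h {i, Suc M} = h 0 i / h 0 (Suc i)"
proof -
  have "{i, Suc M} \<in> chords (Suc (Suc M))" using assms by (simp add: doubleton_in_chords_iff)
  then show ?thesis
    using assms by (simp add: ratio_coords_doubleton cyc_ratio_def skew_def)
qed

lemmas ratio_coords_simps = ratio_coords_inner ratio_coords_last ratio_coords_infinity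

lemma ratio_coords_extensional: "ratio_coords M h \<in> chords (Suc (Suc M)) \<rightarrow>\<^sub>E UNIV"
  by (simp add: ratio_coords_def)

lemma chords_fun_eqI:
  assumes "u \<in> chords (Suc (Suc M)) \<rightarrow>\<^sub>E UNIV" "v \<in> chords (Suc (Suc M)) \<rightarrow>\<^sub>E UNIV"
    and "\<And>i j. Suc i < j \<Longrightarrow> j < M \<Longrightarrow> u {i, j} = v {i, j}"
    and "\<And>i. Suc i < M \<Longrightarrow> u {i, M} = v {i, M}"
    and "\<And>i. 0 < i \<Longrightarrow> i < M \<Longrightarrow> u {i, Suc M} = v {i, Suc M}"
  shows "u = v"
proof (rule PiE_ext[OF assms(1,2)])
  fix c assume "c \<in> chords (Suc (Suc M))"
  then show "u c = v c" by (cases rule: chordsE) (simp_all add: assms(3-5))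
qed

lemma ratio_coords_cong:
  assumes "\<And>i j. i < j \<Longrightarrow> j \<le> M \<Longrightarrow> h i j = h' i j"
  shows "ratio_coords M h = ratio_coords M h'"
  by (rule chords_fun_eqI[OF ratio_coords_extensional ratio_coords_extensional])
    (simp_all add: ratio_coords_simps assms)

lemma ratio_coords_scale:
  assumes "k \<noteq> 0"
  shows "ratio_coords M (\<lambda>i j. k * h i j) = ratio_coords M h"
  by (rule chords_fun_eqI[OF ratio_coords_extensional ratio_coords_extensional])
    (use assms in \<open>simp_all add: ratio_coords_simps\<close>)

text \<open>Coordinates are Laurent monomials in \<open>h\<close> and \<open>sgn\<close> is
  multiplicative, so a sign pattern can be handled as the coordinates of a sign-valued function on
  pairs.\<close>

lemma ratio_coords_sgn:
  assumes "c \<in> chords (Suc (Suc M))"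
  shows "ratio_coords M (\<lambda>i j. sgn (h i j)) c = sgn (ratio_coords M h c)"
  using assms by (cases rule: chordsE) (simp_all add: ratio_coords_simps sgn_mult sgn_divide)

text \<open>Up to the factor \<open>h 0 M\<close>, this Laurent monomial recovers \<open>h i j\<close> from \<open>u = ratio_coords M h\<close>: the
  first product telescopes to \<open>h i M / h 0 M\<close>, the second one to \<open>h i j / h i M\<close>.\<close>

definition pattern_diff :: "nat \<Rightarrow> (nat set \<Rightarrow> real) \<Rightarrow> nat \<Rightarrow> nat \<Rightarrow> real" where
  "pattern_diff M u i j =
     (\<Prod>k<i. u {k, M}) * (\<Prod>k\<in>{j..<M}. u {k, Suc M} * (\<Prod>l<i. u {l, k}))"

lemma prod_telescope:
  fixes f :: "nat \<Rightarrow> real"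
  assumes "\<And>k. m \<le> k \<Longrightarrow> k \<le> n \<Longrightarrow> f k \<noteq> 0" "m \<le> n"
  shows "(\<Prod>k\<in>{m..<n}. f (Suc k) / f k) = f n / f m"
  using assms(2,1)
proof (induction n rule: dec_induct)
  case (step n)
  then show ?case by (simp add: prod.atLeastLessThan_Suc)
qed auto

lemma pattern_diff_ratio_coords:
  assumes nz: "\<And>i j. i < j \<Longrightarrow> j \<le> M \<Longrightarrow> h i j \<noteq> 0" and ij: "i < j" "j \<le> M"
  shows "h i j = h 0 M * pattern_diff M (ratio_coords M h) i j"
proof -
  let ?u = "ratio_coords M h"
  have 1: "(\<Prod>k<i. ?u {k, M}) = h i M / h 0 M"
  proof -
    have "(\<Prod>k<i. ?u {k, M}) = (\<Prod>k\<in>{0..<i}. h (Suc k) M / h k M)"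
      using ij by (intro prod.cong) (auto simp: ratio_coords_last)
    also have "\<dots> = h i M / h 0 M"
      by (rule prod_telescope[where f = "\<lambda>k. h k M"]) (use ij in \<open>simp_all add: nz\<close>)
    finally show ?thesis .
  qed
  \<comment> \<open>The inner product telescopes in \<open>l\<close>, and the factor at infinity,
    \<open>h 0 k / h 0 (Suc k)\<close>, cancels its initial value. What remains telescopes in
    \<open>k\<close>.\<close>
  have 2: "?u {k, Suc M} * (\<Prod>l<i. ?u {l, k}) = h i k / h i (Suc k)" if k: "j \<le> k" "k < M" for k
  proof -
    have "(\<Prod>l<i. ?u {l, k}) =
      (\<Prod>l\<in>{0..<i}. (h (Suc l) k / h (Suc l) (Suc k)) / (h l k / h l (Suc k)))"
      using ij k by (intro prod.cong) (auto simp: ratio_coords_inner mult_ac)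
    also have "\<dots> = (h i k / h i (Suc k)) / (h 0 k / h 0 (Suc k))"
      by (rule prod_telescope[where f = "\<lambda>l. h l k / h l (Suc k)"]) (use ij k in \<open>simp_all add: nz\<close>)
    finally show ?thesis
      using ij k nz[of 0 k] nz[of 0 "Suc k"] by (simp add: ratio_coords_infinity)
  qed
  have "(\<Prod>k\<in>{j..<M}. ?u {k, Suc M} * (\<Prod>l<i. ?u {l, k})) =
    (\<Prod>k\<in>{j..<M}. inverse (h i (Suc k)) / inverse (h i k))"
    by (intro prod.cong) (auto simp: 2 field_simps)
  also have "\<dots> = inverse (h i M) / inverse (h i j)"
    by (rule prod_telescope[where f = "\<lambda>k. inverse (h i k)"]) (use ij in \<open>simp_all add: nz\<close>)
  finally show ?thesis
    using 1 ij nz[of i M] nz[of 0 M] by (simp add: pattern_diff_def inverse_eq_divide)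
qed

lemma pattern_diff_nonzero:
  assumes "\<And>c. c \<in> chords (Suc (Suc M)) \<Longrightarrow> u c \<noteq> 0" "i < j" "j \<le> M"
  shows "pattern_diff M u i j \<noteq> 0"
  using assms by (auto simp: pattern_diff_def doubleton_in_chords_iff)

text \<open>Passing from \<open>Suc j\<close> to \<open>j\<close> multiplies
  \<open>pattern_diff\<close> by the factor in \<open>step\<close>, and raising \<open>i\<close> by
  one appends \<open>u {i, j}\<close> to that factor. The defining quotients therefore return
  \<open>u\<close>, whatever its non-zero values are.\<close>

lemma ratio_coords_pattern_diff:
  assumes nz: "\<And>c. c \<in> chords (Suc (Suc M)) \<Longrightarrow> u c \<noteq> 0"
    and ext: "u \<in> chords (Suc (Suc M)) \<rightarrow>\<^sub>E UNIV"
  shows "ratio_coords M (pattern_diff M u) = u"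
proof -
  let ?E = "pattern_diff M u"
  have E: "?E i j \<noteq> 0" if "i < j" "j \<le> M" for i j
    using pattern_diff_nonzero nz that by blast
  have step: "?E i j = ?E i (Suc j) * (u {j, Suc M} * (\<Prod>l<i. u {l, j}))" if "j < M" for i j
    using that by (simp add: pattern_diff_def prod.atLeast_Suc_lessThan)
  show ?thesis
  proof (rule chords_fun_eqI[OF ratio_coords_extensional ext])
    fix i j assume ij: "Suc i < j" "j < M"
    have "?E (Suc i) j = ?E (Suc i) (Suc j) * (u {j, Suc M} * (\<Prod>l<i. u {l, j})) * u {i, j}"
      using step[of j "Suc i"] ij by simp
    moreover have "u {j, Suc M} * (\<Prod>l<i. u {l, j}) \<noteq> 0"
      using E[of i j] step[of j i] ij by auto
    ultimately show "ratio_coords M ?E {i, j} = u {i, j}"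
      using ij step[of j i] E[of i "Suc j"] E[of "Suc i" "Suc j"]
      by (simp add: ratio_coords_inner)
  next
    fix i assume i: "Suc i < M"
    then show "ratio_coords M ?E {i, M} = u {i, M}"
      using E[of i M] by (simp add: ratio_coords_last pattern_diff_def)
  next
    fix i assume i: "0 < i" "i < M"
    then show "ratio_coords M ?E {i, Suc M} = u {i, Suc M}"
      using step[of i 0] E[of 0 "Suc i"] by (simp add: ratio_coords_infinity)
  qed
qed

section \<open>Affine representatives of configurations\<close>

definition affine_coords :: "nat \<Rightarrow> (nat \<Rightarrow> real) \<Rightarrow> nat set \<Rightarrow> real" where
  "affine_coords M z = ratio_coords M (\<lambda>i j. z i - z j)"

lemma affine_coords_cong:
  "(\<And>i. i \<le> M \<Longrightarrow> z i = w i) \<Longrightarrow> affine_coords M z = affine_coords M w"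
  unfolding affine_coords_def by (rule ratio_coords_cong) simp

text \<open>Translations cancel in the differences, and common factors cancel in the quotients. A
  negative \<open>k\<close> is allowed and gives the reversal of the order.\<close>

lemma affine_coords_affine:
  assumes "k \<noteq> 0"
  shows "affine_coords M (\<lambda>i. k * z i + b) = affine_coords M z"
  using ratio_coords_scale[OF assms, of M "\<lambda>i j. z i - z j"] by (simp add: affine_coords_def right_diff_distrib)

lemma skew_diff: "i \<le> M \<Longrightarrow> j \<le> M \<Longrightarrow> skew M (\<lambda>i j. z i - z j) i j = z i - z j"
  by (simp add: skew_def)

lemma span_eq_if_bracket_eq_0:
  assumes "bracket x y = 0" "x \<noteq> 0" "y \<noteq> 0"
  shows "span {x} = span {y}"
proof -
  have "y \<in> span {x}" if "bracket x y = 0" "x \<noteq> 0" for x y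
  proof -
    have "x$1 \<noteq> 0 \<or> x$2 \<noteq> 0" using that by (auto simp: vec_eq_iff forall_2)
    then have "\<exists>k. y = k *\<^sub>R x"
    proof
      assume "x$1 \<noteq> 0"
      then show ?thesis using that
        by (intro exI[of _ "y$1 / x$1"]) (auto simp: vec_eq_iff forall_2 bracket_def field_simps)
    next
      assume "x$2 \<noteq> 0"
      then show ?thesis using that
        by (intro exI[of _ "y$2 / x$2"]) (auto simp: vec_eq_iff forall_2 bracket_def field_simps)
    qed
    then show ?thesis by (auto simp: span_singleton)
  qed
  moreover have "bracket y x = 0" using assms by (simp add: bracket_def)
  ultimately have "y \<in> span {x}" "x \<in> span {y}" using assms by auto
  then show ?thesis by (simp add: span_eq)
qed

lemma bracket_eq_0_if_span_eq:
  assumes "span {x} = span {y}"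
  shows "bracket x y = 0"
proof -
  have "y \<in> span {x}" using assms by (simp add: span_base)
  then show ?thesis by (auto simp: span_singleton bracket_def)
qed

lemma dihedral_coord_eq_cyc_ratio:
  assumes "c \<in> chords n"
  shows "dihedral_coord n w c = cyc_ratio n (\<lambda>i j. bracket (rep (w i)) (rep (w j))) (Min c) (Max c)"
  by (simp add: dihedral_coord_def cyc_ratio_def cross_ratio_def Let_def)

lemma Min_Max_chord:
  assumes "c \<in> chords n"
  shows "Min c < n" "Max c < n"
  using assms by (auto simp: chords_def)

text \<open>Infinity is represented by \<open>[-1, 0]\<close> and not \<open>[1, 0]\<close>, so that
  a finite point bracketed with it gives \<open>1\<close>, as in \<open>skew\<close>.\<close>

definition affine_vector :: "nat \<Rightarrow> (nat \<Rightarrow> real) \<Rightarrow> nat \<Rightarrow> real^2" where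
  "affine_vector M z i = (if i \<le> M then vector [z i, 1] else vector [-1, 0])"

lemma skew_diff_eq_bracket:
  "i \<le> Suc M \<Longrightarrow> j \<le> Suc M \<Longrightarrow>
    skew M (\<lambda>i j. z i - z j) i j = bracket (affine_vector M z i) (affine_vector M z j)"
  by (auto simp: affine_vector_def skew_def bracket_def)

lemma dihedral_coords_affine:
  fixes z :: "nat \<Rightarrow> real"
  assumes inj: "inj_on z {..M}"
  defines "w \<equiv> \<lambda>i\<in>{..<Suc (Suc M)}. span {affine_vector M z i}"
  shows "w \<in> configurations (Suc (Suc M))"
    and "(\<lambda>c\<in>chords (Suc (Suc M)). dihedral_coord (Suc (Suc M)) w c) = affine_coords M z"
proof -
  let ?v = "affine_vector M z"
  have v0: "?v i \<noteq> 0" for i by (auto simp: affine_vector_def vec_eq_iff forall_2)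
  note br = skew_diff_eq_bracket[symmetric]
  have nz: "skew M (\<lambda>i j. z i - z j) i j \<noteq> 0" if "i < Suc (Suc M)" "j < Suc (Suc M)" "i \<noteq> j" for i j
    using that inj by (intro skew_nonzero) (auto simp: inj_on_def)
  show "w \<in> configurations (Suc (Suc M))"
    unfolding configurations_def
  proof (intro CollectI conjI)
    show "w \<in> {..<Suc (Suc M)} \<rightarrow>\<^sub>E proj_line"
      using v0 unfolding w_def by (auto simp: proj_line_def)
    show "inj_on w {..<Suc (Suc M)}"
    proof (rule inj_onI, rule ccontr)
      fix i j assume ij: "i \<in> {..<Suc (Suc M)}" "j \<in> {..<Suc (Suc M)}" "w i = w j" "i \<noteq> j"
      then have "bracket (?v i) (?v j) = 0"
        unfolding w_def by (intro bracket_eq_0_if_span_eq) simp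
      then show False using ij br[of i M j z] nz[of i j] by simp
    qed
  qed
  show "(\<lambda>c\<in>chords (Suc (Suc M)). dihedral_coord (Suc (Suc M)) w c) = affine_coords M z"
    unfolding affine_coords_def ratio_coords_def
  proof (rule restrict_ext)
    fix c assume c: "c \<in> chords (Suc (Suc M))"
    have "(i + 1) mod Suc (Suc M) < Suc (Suc M)" for i by simp
    then show "dihedral_coord (Suc (Suc M)) w c = cyc_ratio (Suc (Suc M)) (skew M (\<lambda>i j. z i - z j)) (Min c) (Max c)"
      using Min_Max_chord[OF c] v0
      unfolding dihedral_coord_def cyc_ratio_def Let_def w_def
      by (simp add: cross_ratio_span br less_Suc_eq_le del: mod_Suc_eq Suc_eq_plus1)
  qed
qed

lemma affine_representative:
  assumes w: "w \<in> configurations (Suc (Suc M))"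
  obtains z where "inj_on z {..M}"
    "(\<lambda>c\<in>chords (Suc (Suc M)). dihedral_coord (Suc (Suc M)) w c) = affine_coords M z"
proof -
  define v where "v i = rep (w i)" for i
  define B where "B i j = bracket (v i) (v j)" for i j
  have v: "v i \<noteq> 0" "w i = span {v i}" if "i < Suc (Suc M)" for i
  proof -
    have "w i \<in> proj_line" using w that by (auto simp: configurations_def)
    then obtain a where a: "a \<noteq> 0" "w i = span {a}" by (auto simp: proj_line_def)
    then obtain k where k: "k \<noteq> 0" "v i = k *\<^sub>R a" using rep_span unfolding v_def by metis
    then show v0: "v i \<noteq> 0" using a by simp
    have "bracket (v i) a = 0" by (simp add: k bracket_def)
    then show "w i = span {v i}" using span_eq_if_bracket_eq_0 v0 a by simp
  qed
  have B: "B i j \<noteq> 0" if "i < Suc (Suc M)" "j < Suc (Suc M)" "i \<noteq> j" for i j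
    using that v w span_eq_if_bracket_eq_0[of "v i" "v j"]
    by (auto simp: B_def configurations_def inj_on_def)
  have B_commute: "B j i = - B i j" for i j by (simp add: B_def bracket_def)
  define p where "p = v (Suc M)"
  \<comment> \<open>A quarter turn of \<open>p\<close> divided by its squared length, chosen to make
    \<open>bracket e p = 1\<close>.\<close>
  define e :: "real^2" where
    "e = vector [p$2 / ((p$1)\<^sup>2 + (p$2)\<^sup>2), - p$1 / ((p$1)\<^sup>2 + (p$2)\<^sup>2)]"
  have "(p$1)\<^sup>2 + (p$2)\<^sup>2 \<noteq> 0"
    using v(1)[of "Suc M"] unfolding p_def by (simp add: vec_eq_iff forall_2 sum_power2_eq_zero_iff)
  then have e: "bracket e p = 1"
    by (simp add: e_def bracket_def power2_eq_square add_divide_distrib[symmetric] add.commute)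
  \<comment> \<open>The projective coordinate with its pole at \<open>p\<close>, which sends the
    last point to infinity. By the Pluecker relation its differences are the brackets
    \<open>B i j\<close> rescaled by \<open>l\<close>; the value \<open>1\<close> of
    \<open>l\<close> at \<open>Suc M\<close> matches the value \<open>1\<close> of
    \<open>skew\<close> at infinity.\<close>
  define z where "z i = bracket (v i) e / B i (Suc M)" for i
  define l where "l i = (if i = Suc M then 1 else 1 / B i (Suc M))" for i
  have "bracket x e * bracket y p - bracket y e * bracket x p = bracket x y * bracket e p" for x y
    by (simp add: bracket_def algebra_simps)
  then have plucker: "bracket (v i) e * B j (Suc M) - bracket (v j) e * B i (Suc M) = B i j" for i j
    using e by (simp add: B_def p_def)
  have diff: "z i - z j = l i * l j * B i j" if "i \<le> M" "j \<le> M" for i j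
    using that B[of i "Suc M"] B[of j "Suc M"] plucker[of i j]
    by (simp add: z_def l_def field_simps)
  have l: "l i \<noteq> 0" if "i < Suc (Suc M)" for i
    using B[of i "Suc M"] that by (auto simp: l_def)
  have skew: "skew M (\<lambda>i j. z i - z j) i j = l i * l j * B i j"
    if lt: "i < Suc (Suc M)" "j < Suc (Suc M)" for i j
  proof -
    consider "i \<le> M" "j \<le> M" | "i = Suc M" "j = Suc M" | "i \<le> M" "j = Suc M" | "i = Suc M" "j \<le> M"
      using lt by linarith
    then show ?thesis
    proof cases
      case 1
      then show ?thesis using diff skew_diff by simp
    next
      case 2
      then show ?thesis using B_commute[of i i] by (simp add: skew_def)
    next
      case 3
      then show ?thesis using B[of i "Suc M"] by (simp add: skew_def l_def)
    next
      case 4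
      then show ?thesis using B[of j "Suc M"] B_commute[of "Suc M" j] by (simp add: skew_def l_def)
    qed
  qed
  have "inj_on z {..M}"
  proof (rule inj_onI, rule ccontr)
    fix i j assume ij: "i \<in> {..M}" "j \<in> {..M}" "z i = z j" "i \<noteq> j"
    then have "l i * l j * B i j = 0" using diff[of i j] by simp
    then show False using ij l B by auto
  qed
  moreover have "(\<lambda>c\<in>chords (Suc (Suc M)). dihedral_coord (Suc (Suc M)) w c) = affine_coords M z"
    unfolding affine_coords_def ratio_coords_def
  proof (rule restrict_ext)
    fix c assume c: "c \<in> chords (Suc (Suc M))"
    show "dihedral_coord (Suc (Suc M)) w c = cyc_ratio (Suc (Suc M)) (skew M (\<lambda>i j. z i - z j)) (Min c) (Max c)"
      using dihedral_coord_eq_cyc_ratio[OF c] cyc_ratio_rescale[OF skew l] Min_Max_chord[OF c]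
      by (simp add: B_def v_def)
  qed
  ultimately show thesis by (rule that)
qed

lemma image_dihedral_map:
  "dihedral_map (Suc (Suc M)) ` M0 (Suc (Suc M)) = {affine_coords M z | z. inj_on z {..M}}"
proof -
  have "dihedral_map n ` M0 n = (\<lambda>w. \<lambda>c\<in>chords n. dihedral_coord n w c) ` configurations n" for n
  proof -
    have "M0 n = (\<lambda>w. pgl_equiv n `` {w}) ` configurations n"
      by (auto simp: M0_def quotient_def)
    then show ?thesis
      by (simp only: image_image) (intro image_cong refl dihedral_map_class)
  qed
  then have image: "dihedral_map (Suc (Suc M)) ` M0 (Suc (Suc M)) =
    (\<lambda>w. \<lambda>c\<in>chords (Suc (Suc M)). dihedral_coord (Suc (Suc M)) w c) ` configurations (Suc (Suc M))" .
  show ?thesis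
  proof (intro set_eqI iffI)
    fix u assume "u \<in> dihedral_map (Suc (Suc M)) ` M0 (Suc (Suc M))"
    then obtain w where "w \<in> configurations (Suc (Suc M))"
      "u = (\<lambda>c\<in>chords (Suc (Suc M)). dihedral_coord (Suc (Suc M)) w c)"
      unfolding image by blast
    then show "u \<in> {affine_coords M z | z. inj_on z {..M}}"
      using affine_representative[of w M] by blast
  next
    fix u assume "u \<in> {affine_coords M z | z. inj_on z {..M}}"
    then obtain z where "u = affine_coords M z" "inj_on z {..M}" by blast
    then show "u \<in> dihedral_map (Suc (Suc M)) ` M0 (Suc (Suc M))"
      unfolding image using dihedral_coords_affine[of z M] by (simp add: rev_image_eqI)
  qed
qed

text \<open>Both inclusions compare \<open>s\<close> with the coordinates of the signs of the
  differences, and pass between the two by \<open>ratio_coords\<close> and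
  \<open>pattern_diff\<close>. As \<open>pattern_diff M s 0 M\<close> is an empty product, the
  right-hand side selects representatives with \<open>z M < z 0\<close>.\<close>

lemma M0_signed_eq:
  assumes M: "1 \<le> M" and s: "s \<in> chords (Suc (Suc M)) \<rightarrow>\<^sub>E {1, -1}"
  shows "M0_signed (Suc (Suc M)) s =
    affine_coords M ` {z. \<forall>i j. i < j \<longrightarrow> j \<le> M \<longrightarrow> sgn (z i - z j) = pattern_diff M s i j}"
    (is "?L = ?R")
proof
  have s0: "s c \<noteq> 0" if "c \<in> chords (Suc (Suc M))" for c
    using s that by (auto simp: PiE_iff)
  show "?R \<subseteq> ?L"
  proof (clarify)
    fix z :: "nat \<Rightarrow> real"
    assume z: "\<forall>i j. i < j \<longrightarrow> j \<le> M \<longrightarrow> sgn (z i - z j) = pattern_diff M s i j"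
    have "z i \<noteq> z j" if "i < j" "j \<le> M" for i j
      using z that pattern_diff_nonzero[of M s i j] s0 by fastforce
    then have "inj_on z {..M}" by (auto simp: inj_on_def) (metis linorder_neqE_nat)
    moreover have "sgn (affine_coords M z c) = s c" if c: "c \<in> chords (Suc (Suc M))" for c
    proof -
      have "sgn (affine_coords M z c) = ratio_coords M (\<lambda>i j. sgn (z i - z j)) c"
        using c by (simp add: affine_coords_def ratio_coords_sgn)
      also have "ratio_coords M (\<lambda>i j. sgn (z i - z j)) = ratio_coords M (pattern_diff M s)"
        using z by (intro ratio_coords_cong) simp
      also have "\<dots> = s" using s s0 by (intro ratio_coords_pattern_diff) (auto simp: PiE_iff)
      finally show ?thesis .
    qed
    ultimately show "affine_coords M z \<in> ?L"
      by (auto simp: M0_signed_def image_dihedral_map orthant_def affine_coords_def ratio_coords_extensional)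
  qed
  show "?L \<subseteq> ?R"
  proof
    fix u assume "u \<in> ?L"
    then obtain z where z: "u = affine_coords M z" "inj_on z {..M}"
      and sg: "\<And>c. c \<in> chords (Suc (Suc M)) \<Longrightarrow> sgn (u c) = s c"
      by (auto simp: M0_signed_def image_dihedral_map orthant_def)
    have "ratio_coords M (\<lambda>i j. sgn (z i - z j)) = s"
    proof (rule PiE_ext[OF ratio_coords_extensional])
      show "s \<in> chords (Suc (Suc M)) \<rightarrow>\<^sub>E UNIV" using s by (auto simp: PiE_iff)
    qed (use sg z in \<open>simp_all add: ratio_coords_sgn affine_coords_def\<close>)
    moreover have "sgn (z i - z j) \<noteq> 0" if "i < j" "j \<le> M" for i j
      using that z(2) by (auto simp: sgn_eq_0_iff inj_on_def)
    ultimately have *: "sgn (z i - z j) = sgn (z 0 - z M) * pattern_diff M s i j" if "i < j" "j \<le> M" for i j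
      using pattern_diff_ratio_coords[of M "\<lambda>i j. sgn (z i - z j)" i j] that by simp
    \<comment> \<open>Reversing the order if \<open>z 0 < z M\<close> turns the free factor into
      \<open>1\<close> and leaves the coordinates unchanged.\<close>
    define k where "k = sgn (z 0 - z M)"
    have "z 0 \<noteq> z M" using z(2) M by (auto simp: inj_on_def)
    then have k: "k * k = 1" "k \<noteq> 0" by (auto simp: k_def sgn_if)
    have "sgn (k * z i - k * z j) = pattern_diff M s i j" if "i < j" "j \<le> M" for i j
    proof -
      have "sgn (k * z i - k * z j) = k * sgn (z i - z j)"
        by (simp add: right_diff_distrib[symmetric] sgn_mult) (simp add: k_def)
      also have "\<dots> = (k * k) * pattern_diff M s i j" using *[OF that] by (simp add: k_def)
      finally show ?thesis using k by simp
    qed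
    moreover have "u = affine_coords M (\<lambda>i. k * z i)"
      using affine_coords_affine[of k M z 0] z k by simp
    ultimately show "u \<in> ?R" by blast
  qed
qed

section \<open>Extended relations and consistency\<close>

lemma cyc_interval_eq_image:
  assumes "a < n" "b < n"
  shows "cyc_interval n a b = (\<lambda>k. (a + k) mod n) ` {..<(b + n - a) mod n}"
proof (intro set_eqI iffI)
  fix x assume x: "x \<in> cyc_interval n a b"
  then have "x < n" by (simp add: cyc_interval_def)
  then have "x = (a + (x + n - a) mod n) mod n"
    using assms by (cases "a \<le> x") (simp_all add: mod_add_right_eq)
  then show "x \<in> (\<lambda>k. (a + k) mod n) ` {..<(b + n - a) mod n}"
    using x by (auto simp: cyc_interval_def)
next
  fix x assume "x \<in> (\<lambda>k. (a + k) mod n) ` {..<(b + n - a) mod n}"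
  then obtain k where k: "x = (a + k) mod n" "k < (b + n - a) mod n" by auto
  moreover have "(b + n - a) mod n < n" using assms by simp
  ultimately have "k < n" by linarith
  have "(x + n - a) mod n = k"
  proof (cases "a + k < n")
    case True
    then show ?thesis using k \<open>k < n\<close> by simp
  next
    case False
    then have "x = a + k - n" using k \<open>k < n\<close> assms by (simp add: le_mod_geq)
    then show ?thesis using False \<open>k < n\<close> by simp
  qed
  then show "x \<in> cyc_interval n a b" using k assms by (auto simp: cyc_interval_def)
qed

lemma prod_cyc_interval_telescope:
  fixes g :: "nat \<Rightarrow> real"
  assumes ab: "a < n" "b < n"
    and nz: "\<And>x. x \<in> cyc_interval n a b \<Longrightarrow> g x \<noteq> 0" "g b \<noteq> 0"
  shows "(\<Prod>x\<in>cyc_interval n a b. g ((x + 1) mod n) / g x) = g b / g a"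
proof -
  let ?m = "(b + n - a) mod n"
  define G where "G k = g ((a + k) mod n)" for k
  have m: "?m < n" using ab by simp
  have b: "(a + ?m) mod n = b" using ab by (simp add: mod_add_right_eq)
  have inj: "inj_on (\<lambda>k. (a + k) mod n) {..<?m}"
  proof (rule inj_onI)
    fix k l assume "k \<in> {..<?m}" "l \<in> {..<?m}" "(a + k) mod n = (a + l) mod n"
    then show "k = l" using m ab by (auto simp: mod_if split: if_splits)
  qed
  have "(\<Prod>x\<in>cyc_interval n a b. g ((x + 1) mod n) / g x) = (\<Prod>k\<in>{0..<?m}. G (Suc k) / G k)"
    unfolding cyc_interval_eq_image[OF ab] prod.reindex[OF inj]
    by (intro prod.cong) (auto simp: G_def mod_simps)
  also have "\<dots> = G ?m / G 0"
  proof (rule prod_telescope)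
    fix k assume "k \<le> ?m"
    show "G k \<noteq> 0"
    proof (cases "k = ?m")
      case True
      then show ?thesis using b nz(2) by (simp add: G_def)
    next
      case False
      then show ?thesis using \<open>k \<le> ?m\<close> nz(1) by (auto simp: G_def cyc_interval_eq_image[OF ab])
    qed
  qed simp
  finally show ?thesis using b ab by (simp add: G_def)
qed

lemma Suc_mod_in_cyc_interval:
  assumes "a < n" "b < n" "x \<in> cyc_interval n a b"
  shows "(x + 1) mod n \<in> insert b (cyc_interval n a b)"
proof -
  let ?m = "(b + n - a) mod n"
  obtain k where k: "x = (a + k) mod n" "k < ?m"
    using assms by (auto simp: cyc_interval_eq_image)
  then have x: "(x + 1) mod n = (a + Suc k) mod n" by (simp add: mod_simps)
  show ?thesis
  proof (cases "Suc k = ?m")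
    case True
    then have "(x + 1) mod n = (a + (b + n - a)) mod n" using x by (metis mod_add_right_eq)
    then show ?thesis using assms by simp
  next
    case False
    then have "(a + Suc k) mod n \<in> (\<lambda>k. (a + k) mod n) ` {..<?m}"
      using k by (intro image_eqI[of _ _ "Suc k"]) auto
    then show ?thesis unfolding x using assms by (simp add: cyc_interval_eq_image)
  qed
qed

text \<open>A coordinate is a quotient of quotients: the product telescopes in \<open>j\<close> for
  fixed \<open>i\<close>, and the result telescopes in \<open>i\<close>. So a monomial of an
  extended relation is a single cross-ratio of the four cut points.\<close>

lemma prod_cyc_ratio:
  assumes lt: "a < n" "b < n" "c < n" "d < n"
    and nz: "\<And>i j. i \<in> insert b (cyc_interval n a b) \<Longrightarrow> j \<in> insert d (cyc_interval n c d) \<Longrightarrow> B i j \<noteq> 0"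
    and mem: "a \<in> cyc_interval n a b" "c \<in> cyc_interval n c d"
  shows "(\<Prod>i\<in>cyc_interval n a b. \<Prod>j\<in>cyc_interval n c d. cyc_ratio n B i j) =
    (B b c * B a d) / (B b d * B a c)"
proof -
  have inner: "(\<Prod>j\<in>cyc_interval n c d. cyc_ratio n B i j) =
    (B ((i + 1) mod n) c / B ((i + 1) mod n) d) / (B i c / B i d)" if i: "i \<in> cyc_interval n a b" for i
  proof -
    have i': "(i + 1) mod n \<in> insert b (cyc_interval n a b)"
      using Suc_mod_in_cyc_interval lt i by blast
    have "(\<Prod>j\<in>cyc_interval n c d. cyc_ratio n B i j) =
      (\<Prod>j\<in>cyc_interval n c d. (B i ((j + 1) mod n) / B ((i + 1) mod n) ((j + 1) mod n)) /
         (B i j / B ((i + 1) mod n) j))"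
      by (simp add: cyc_ratio_def mult_ac)
    also have "\<dots> = (B i d / B ((i + 1) mod n) d) / (B i c / B ((i + 1) mod n) c)"
      by (rule prod_cyc_interval_telescope[where g = "\<lambda>j. B i j / B ((i + 1) mod n) j"])
        (use lt nz i i' in auto)
    finally show ?thesis by (simp add: mult_ac)
  qed
  have "(\<Prod>i\<in>cyc_interval n a b. \<Prod>j\<in>cyc_interval n c d. cyc_ratio n B i j) =
    (\<Prod>i\<in>cyc_interval n a b. (B ((i + 1) mod n) c / B ((i + 1) mod n) d) / (B i c / B i d))"
    by (intro prod.cong) (simp_all add: inner)
  also have "\<dots> = (B b c / B b d) / (B a c / B a d)"
    by (rule prod_cyc_interval_telescope[where g = "\<lambda>i. B i c / B i d"]) (use lt nz mem in auto)
  finally show ?thesis by (simp add: mult_ac)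
qed

lemma cyc_interval_start:
  assumes "a < n" "b < n" "cyc_interval n a b \<noteq> {}"
  shows "a \<in> cyc_interval n a b"
proof -
  have "0 < (b + n - a) mod n" using assms(3) by (auto simp: cyc_interval_def)
  then show ?thesis using assms by (simp add: cyc_interval_def)
qed

text \<open>Keeps the cut points of a \<open>cyclic_partition\<close>, because the telescoped
  monomials are expressed through them.\<close>

definition cyclic_cut :: "nat \<Rightarrow> nat \<Rightarrow> nat \<Rightarrow> nat \<Rightarrow> nat \<Rightarrow> bool" where
  "cyclic_cut n a b c d \<longleftrightarrow> a < n \<and> b < n \<and> c < n \<and> d < n \<and>
     distinct [cyc_interval n a b, cyc_interval n b c, cyc_interval n c d, cyc_interval n d a] \<and>
     partition_on {..<n}
       {cyc_interval n a b, cyc_interval n b c, cyc_interval n c d, cyc_interval n d a}"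

lemma cyclic_partition_iff_cut:
  "cyclic_partition n A B C D \<longleftrightarrow>
    (\<exists>a b c d. cyclic_cut n a b c d \<and> A = cyc_interval n a b \<and> B = cyc_interval n b c \<and>
       C = cyc_interval n c d \<and> D = cyc_interval n d a)"
  unfolding cyclic_partition_def cyclic_cut_def by blast

text \<open>The second monomial of a cut is the first monomial of the rotated cut, so facts about
  the first one suffice.\<close>

lemma cyclic_cut_rotate:
  assumes "cyclic_cut n a b c d"
  shows "cyclic_cut n b c d a"
proof -
  have "{cyc_interval n b c, cyc_interval n c d, cyc_interval n d a, cyc_interval n a b} =
    {cyc_interval n a b, cyc_interval n b c, cyc_interval n c d, cyc_interval n d a}"
    by blast
  moreover have "distinct [B, C, D, A]" if "distinct [A, B, C, D]" for A B C D :: "nat set"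
    using that by auto
  ultimately show ?thesis using assms unfolding cyclic_cut_def by (simp only:)
qed

lemma cyclic_cut_start:
  assumes "cyclic_cut n a b c d"
  shows "a \<in> cyc_interval n a b"
proof (rule cyc_interval_start)
  show "a < n" "b < n" using assms by (simp_all add: cyclic_cut_def)
  show "cyc_interval n a b \<noteq> {}"
    using assms by (simp only: cyclic_cut_def partition_on_def) blast
qed

text \<open>Here \<open>b\<close> starts the second part and \<open>d\<close> the fourth, so
  adjoining them keeps the arcs apart. The telescoping products end at these adjoined points, so
  this makes all brackets in them non-zero.\<close>

lemma cyclic_cut_disjoint:
  assumes "cyclic_cut n a b c d"
  shows "insert b (cyc_interval n a b) \<inter> insert d (cyc_interval n c d) = {}"
proof -
  let ?A = "cyc_interval n a b" and ?B = "cyc_interval n b c"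
  let ?C = "cyc_interval n c d" and ?D = "cyc_interval n d a"
  have mem: "b \<in> ?B" "d \<in> ?D"
    using assms cyclic_cut_rotate cyclic_cut_start by blast+
  have "disjoint {?A, ?B, ?C, ?D}" "?A \<noteq> ?C" "?A \<noteq> ?D" "?B \<noteq> ?C" "?B \<noteq> ?D"
    using assms by (simp_all add: cyclic_cut_def partition_on_def)
  then have "?A \<inter> ?C = {}" "?A \<inter> ?D = {}" "?B \<inter> ?C = {}" "?B \<inter> ?D = {}"
    by (simp_all add: disjoint_def)
  then show ?thesis using mem by blast
qed

text \<open>Successors stay in the two closed arcs of \<open>cyclic_cut_disjoint\<close>, so
  \<open>i\<close> and \<open>j\<close> are neither equal nor adjacent.\<close>

lemma cyclic_cut_chord:
  assumes cut: "cyclic_cut n a b c d" and ij: "i \<in> cyc_interval n a b" "j \<in> cyc_interval n c d"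
  shows "{i, j} \<in> chords n"
proof -
  have "i < n" "j < n" using ij by (auto simp: cyc_interval_def)
  moreover have "(i + 1) mod n \<in> insert b (cyc_interval n a b)"
    "(j + 1) mod n \<in> insert d (cyc_interval n c d)"
    using cut ij Suc_mod_in_cyc_interval by (auto simp: cyclic_cut_def)
  then have "j \<noteq> i" "j \<noteq> (i + 1) mod n" "i \<noteq> (j + 1) mod n"
    using cyclic_cut_disjoint[OF cut] ij by blast+
  ultimately show ?thesis unfolding chords_def by blast
qed

text \<open>The generality in \<open>h\<close> matters: it is also applied to
  \<open>pattern_diff M s\<close> for a pattern not yet known to be realizable.\<close>

lemma prod_ratio_coords_cyclic_cut:
  assumes cut: "cyclic_cut (Suc (Suc M)) a b c d"
    and h: "\<And>i j. i < j \<Longrightarrow> j \<le> M \<Longrightarrow> h i j \<noteq> 0"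
  shows "(\<Prod>i\<in>cyc_interval (Suc (Suc M)) a b. \<Prod>j\<in>cyc_interval (Suc (Suc M)) c d.
      ratio_coords M h {i, j}) =
    (skew M h b c * skew M h a d) / (skew M h b d * skew M h a c)"
proof -
  let ?n = "Suc (Suc M)"
  have lt: "a < ?n" "b < ?n" "c < ?n" "d < ?n" using cut by (auto simp: cyclic_cut_def)
  have mem: "a \<in> cyc_interval ?n a b" "c \<in> cyc_interval ?n c d"
    using cut cyclic_cut_rotate cyclic_cut_start by blast+
  have "(\<Prod>i\<in>cyc_interval ?n a b. \<Prod>j\<in>cyc_interval ?n c d. ratio_coords M h {i, j}) =
    (\<Prod>i\<in>cyc_interval ?n a b. \<Prod>j\<in>cyc_interval ?n c d. cyc_ratio ?n (skew M h) i j)"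
    using cyclic_cut_chord[OF cut] by (intro prod.cong refl) (simp add: ratio_coords_doubleton)
  also have "\<dots> = (skew M h b c * skew M h a d) / (skew M h b d * skew M h a c)"
  proof (rule prod_cyc_ratio[OF lt _ mem])
    fix i j assume ij: "i \<in> insert b (cyc_interval ?n a b)" "j \<in> insert d (cyc_interval ?n c d)"
    then have "i < ?n" "j < ?n" using lt by (auto simp: cyc_interval_def)
    moreover have "i \<noteq> j" using ij cyclic_cut_disjoint[OF cut] by blast
    ultimately show "skew M h i j \<noteq> 0" using h by (intro skew_nonzero) auto
  qed
  finally show ?thesis .
qed

text \<open>The Pluecker relation of vectors in the plane. Divided by its right-hand side it becomes
  the extended relation; this is where true differences are needed.\<close>

lemma skew_diff_plucker:
  fixes M z
  defines "b \<equiv> skew M (\<lambda>i j. z i - z j)"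
  assumes "i \<le> Suc M" "j \<le> Suc M" "k \<le> Suc M" "l \<le> Suc M"
  shows "b i j * b k l + b i l * b j k = b i k * b j l"
  unfolding b_def using assms by (simp add: skew_diff_eq_bracket bracket_def algebra_simps)

lemma sgn_prod_real:
  fixes f :: "'a \<Rightarrow> real"
  shows "sgn (\<Prod>x\<in>A. f x) = (\<Prod>x\<in>A. sgn (f x))"
  by (induction A rule: infinite_finite_induct) (simp_all add: sgn_mult)

lemma consistent_if_M0_signed_nonempty:
  assumes "M0_signed (Suc (Suc M)) s \<noteq> {}"
  shows "consistent (Suc (Suc M)) s"
  unfolding consistent_def
proof (intro notI, elim exE conjE)
  let ?n = "Suc (Suc M)"
  fix A B C D
  assume "cyclic_partition ?n A B C D"
    and neg: "(\<Prod>i\<in>A. \<Prod>j\<in>C. s {i, j}) = - 1" "(\<Prod>k\<in>B. \<Prod>l\<in>D. s {k, l}) = - 1"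
  then obtain a b c d where cut: "cyclic_cut ?n a b c d"
    and eq: "A = cyc_interval ?n a b" "B = cyc_interval ?n b c"
      "C = cyc_interval ?n c d" "D = cyc_interval ?n d a"
    by (auto simp: cyclic_partition_iff_cut)
  note cut' = cyclic_cut_rotate[OF cut]
  obtain z where z: "inj_on z {..M}"
    and sg: "\<And>c. c \<in> chords ?n \<Longrightarrow> sgn (affine_coords M z c) = s c"
    using assms by (auto simp: M0_signed_def image_dihedral_map orthant_def)
  define S where "S = skew M (\<lambda>i j. z i - z j)"
  let ?P = "\<Prod>i\<in>A. \<Prod>j\<in>C. affine_coords M z {i, j}"
  let ?Q = "\<Prod>k\<in>B. \<Prod>l\<in>D. affine_coords M z {k, l}"
  have nz: "z i - z j \<noteq> 0" if "i < j" "j \<le> M" for i j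
    using z that by (auto simp: inj_on_def)
  have lt: "a \<le> Suc M" "b \<le> Suc M" "c \<le> Suc M" "d \<le> Suc M"
    using cut by (auto simp: cyclic_cut_def)
  have "a \<noteq> c" "b \<noteq> d"
    using cyclic_cut_disjoint[OF cut] cyclic_cut_start[OF cut]
      cyclic_cut_start[OF cyclic_cut_rotate[OF cut']] by blast+
  then have S: "S a c \<noteq> 0" "S b d \<noteq> 0"
    unfolding S_def using nz lt by (intro skew_nonzero; simp)+
  have "sgn ?P = (\<Prod>i\<in>A. \<Prod>j\<in>C. s {i, j})"
    using cyclic_cut_chord[OF cut] eq by (simp add: sgn_prod_real sg)
  then have "?P < 0" using neg by (simp add: sgn_if split: if_splits)
  moreover have "sgn ?Q = (\<Prod>k\<in>B. \<Prod>l\<in>D. s {k, l})"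
    using cyclic_cut_chord[OF cut'] eq by (simp add: sgn_prod_real sg)
  then have "?Q < 0" using neg by (simp add: sgn_if split: if_splits)
  \<comment> \<open>The extended relation: two sign changes give both cross-ratios the same
    denominator, and the numerators add up by the Pluecker relation.\<close>
  moreover have "?P + ?Q = 1"
  proof -
    have P: "?P = (S b c * S a d) / (S b d * S a c)"
      unfolding eq affine_coords_def S_def by (rule prod_ratio_coords_cyclic_cut[OF cut nz])
    have "?Q = (S c d * S b a) / (S c a * S b d)"
      unfolding eq affine_coords_def S_def by (rule prod_ratio_coords_cyclic_cut[OF cut' nz])
    also have "\<dots> = (S c d * S a b) / (S a c * S b d)"
      using skew_commute[of M _ a b] skew_commute[of M _ a c] by (simp add: S_def)
    finally have "?P + ?Q = (S a b * S c d + S a d * S b c) / (S a c * S b d)"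
      unfolding P by (simp add: add_divide_distrib mult_ac)
    also have "S a b * S c d + S a d * S b c = S a c * S b d"
      unfolding S_def using lt by (intro skew_diff_plucker)
    finally show ?thesis using S by simp
  qed
  ultimately show False by linarith
qed

lemma cyc_interval_eq_atLeastLessThan:
  assumes "a \<le> b" "b < n"
  shows "cyc_interval n a b = {a..<b}"
proof -
  have "(b + n - a) mod n = b - a" using assms by (simp add: mod_if)
  moreover have "(x + n - a) mod n = (if a \<le> x then x - a else x + n - a)" if "x < n" for x
    using assms that by (auto simp: mod_if)
  ultimately have "x \<in> cyc_interval n a b \<longleftrightarrow> x \<in> {a..<b}" for x
    using assms by (cases "x < n") (auto simp: cyc_interval_def)
  then show ?thesis by blast
qed

lemma cyc_interval_wrap:
  assumes "a \<le> Suc M"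
  shows "cyc_interval (Suc (Suc M)) (Suc M) a = (if a = Suc M then {} else insert (Suc M) {..<a})"
proof -
  have "(x + Suc (Suc M) - Suc M) mod Suc (Suc M) = (if x = Suc M then 0 else Suc x)" if "x < Suc (Suc M)" for x
    using that by auto
  then show ?thesis using assms by (auto simp: cyc_interval_def)
qed

text \<open>The fourth part always contains \<open>Suc M\<close>, so \<open>i = 0\<close> is allowed
  and every triple of finite labels yields a relation.\<close>

lemma cyclic_cut_infinity:
  assumes "i < j" "j < k" "k \<le> M"
  shows "cyclic_cut (Suc (Suc M)) i j k (Suc M)"
proof -
  let ?n = "Suc (Suc M)"
  define A B C D where ABCD: "A = cyc_interval ?n i j" "B = cyc_interval ?n j k"
    "C = cyc_interval ?n k (Suc M)" "D = cyc_interval ?n (Suc M) i"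
  have eq: "A = {i..<j}" "B = {j..<k}" "C = {k..<Suc M}" "D = insert (Suc M) {..<i}"
    using assms unfolding ABCD by (simp_all add: cyc_interval_eq_atLeastLessThan cyc_interval_wrap)
  have "i \<in> A" "i \<notin> B" "i \<notin> C" "i \<notin> D" "j \<in> B" "j \<notin> C" "j \<notin> D" "k \<in> C" "k \<notin> D"
    using assms by (auto simp: eq)
  then have "distinct [A, B, C, D]" by auto
  moreover have "partition_on {..<?n} {A, B, C, D}"
    using assms by (auto simp: eq partition_on_def disjoint_def)
  ultimately show ?thesis
    using assms unfolding cyclic_cut_def ABCD by simp
qed

section \<open>Consistent patterns come from linear orders\<close>

text \<open>Brackets with infinity are \<open>1\<close> or \<open>-1\<close>, so the two monomials
  reduce to \<open>h j k / h i k\<close> and \<open>h i j / h i k\<close>. In a cyclic triangle both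
  equal \<open>-1\<close>, against consistency.\<close>

lemma consistent_no_three_cycle:
  assumes con: "consistent (Suc (Suc M)) s"
    and s: "s \<in> chords (Suc (Suc M)) \<rightarrow>\<^sub>E {1, -1}"
    and ijk: "i < j" "j < k" "k \<le> M"
  defines "h \<equiv> pattern_diff M s"
  shows "\<not> (h i j = - h i k \<and> h j k = - h i k)"
proof
  assume eq: "h i j = - h i k \<and> h j k = - h i k"
  let ?n = "Suc (Suc M)"
  have s0: "s c \<noteq> 0" if "c \<in> chords ?n" for c
    using s that by (auto simp: PiE_iff)
  have h0: "h i j \<noteq> 0" if "i < j" "j \<le> M" for i j
    unfolding h_def using s0 that by (rule pattern_diff_nonzero)
  have h: "ratio_coords M h = s"
    unfolding h_def using s s0 by (intro ratio_coords_pattern_diff) (auto simp: PiE_iff)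
  note cut = cyclic_cut_infinity[OF ijk] and cut' = cyclic_cut_rotate[OF cyclic_cut_infinity[OF ijk]]
  have "h i k \<noteq> 0" using h0 ijk by simp
  then have "(\<Prod>p\<in>cyc_interval ?n i j. \<Prod>q\<in>cyc_interval ?n k (Suc M). s {p, q}) = - 1"
    "(\<Prod>p\<in>cyc_interval ?n j k. \<Prod>q\<in>cyc_interval ?n (Suc M) i. s {p, q}) = - 1"
    using prod_ratio_coords_cyclic_cut[OF cut, of h, OF h0]
      prod_ratio_coords_cyclic_cut[OF cut', of h, OF h0] eq ijk
    unfolding h by (simp_all add: skew_def)
  moreover have "cyclic_partition ?n (cyc_interval ?n i j) (cyc_interval ?n j k)
      (cyc_interval ?n k (Suc M)) (cyc_interval ?n (Suc M) i)"
    using cut by (auto simp: cyclic_partition_iff_cut)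
  ultimately show False using con unfolding consistent_def by blast
qed

lemma pattern_diff_sign:
  assumes "s \<in> chords (Suc (Suc M)) \<rightarrow>\<^sub>E {1, -1}" "i < j" "j \<le> M"
  shows "pattern_diff M s i j = 1 \<or> pattern_diff M s i j = - 1"
proof -
  have "\<bar>s c\<bar> = 1" if "c \<in> chords (Suc (Suc M))" for c
    using assms(1) that by (auto simp: PiE_iff)
  then have "\<bar>pattern_diff M s i j\<bar> = 1"
    using assms(2,3) by (simp add: pattern_diff_def abs_mult abs_prod doubleton_in_chords_iff)
  then show ?thesis by linarith
qed

text \<open>A tournament without cyclic triangles is a linear order, and \<open>r\<close> counts the labels above a given
  one.\<close>

lemma consistent_obtains_ranking:
  assumes con: "consistent (Suc (Suc M)) s"
    and s: "s \<in> chords (Suc (Suc M)) \<rightarrow>\<^sub>E {1, -1}"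
  obtains r where "bij_betw r {..M} {..M}"
    "\<And>i j. i < j \<Longrightarrow> j \<le> M \<Longrightarrow> pattern_diff M s i j = (if r i < r j then 1 else - 1)"
proof -
  define S where "S = skew M (pattern_diff M s)"
  have S_commute: "S j i = - S i j" for i j
    unfolding S_def by (rule skew_commute)
  have S_less: "S i j = pattern_diff M s i j" if "i < j" "j \<le> M" for i j
    using that by (simp add: S_def skew_def)
  have S_self: "S i i = 0" for i by (simp add: S_def skew_def)
  have sign: "S i j = 1 \<or> S i j = - 1" if "i \<le> M" "j \<le> M" "i \<noteq> j" for i j
  proof (cases "i < j")
    case True
    then show ?thesis using pattern_diff_sign[OF s] S_less that by simp
  next
    case False
    then have "j < i" using that by simp
    then show ?thesis
      using pattern_diff_sign[OF s, of j i] S_less[of j i] S_commute[of j i] that by auto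
  qed
  have cycle: "\<not> (S i j = - S i k \<and> S j k = - S i k)" if "i < j" "j < k" "k \<le> M" for i j k
    using consistent_no_three_cycle[OF con s that] S_less that by simp
  have trans: "S x z = 1" if xyz: "S x y = 1" "S y z = 1" "x \<le> M" "y \<le> M" "z \<le> M" for x y z
  proof (rule ccontr)
    have ne: "x \<noteq> y" "y \<noteq> z" "x \<noteq> z" using xyz S_self S_commute[of x y] by auto
    assume "S x z \<noteq> 1"
    then have xz: "S x z = - 1" using sign xyz ne by blast
    note vals = xyz xz S_commute[of x y] S_commute[of y z] S_commute[of x z]
    \<comment> \<open>A failure of transitivity is a cyclic triangle on \<open>x\<close>,
      \<open>y\<close>, \<open>z\<close>, but \<open>cycle\<close> speaks of increasing labels only;
      antisymmetry of \<open>S\<close> reduces each of the six orders to it.\<close>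
    consider "x < y" "y < z" | "x < z" "z < y" | "y < x" "x < z" | "y < z" "z < x" | "z < x" "x < y" | "z < y" "y < x"
      using ne by linarith
    then show False
    proof cases
      case 1
      then show ?thesis using cycle[of x y z] vals by simp
    next
      case 2
      then show ?thesis using cycle[of x z y] vals by simp
    next
      case 3
      then show ?thesis using cycle[of y x z] vals by simp
    next
      case 4
      then show ?thesis using cycle[of y z x] vals by simp
    next
      case 5
      then show ?thesis using cycle[of z x y] vals by simp
    next
      case 6
      then show ?thesis using cycle[of z y x] vals by simp
    qed
  qed
  define r where "r x = card {y. y \<le> M \<and> S y x = 1}" for x
  have fin: "finite {y. y \<le> M \<and> S y x = 1}" for x by simp
  have mono: "r x < r y" if "S x y = 1" "x \<le> M" "y \<le> M" for x y
  proof -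
    have "{w. w \<le> M \<and> S w x = 1} \<subset> {w. w \<le> M \<and> S w y = 1}"
    proof (rule psubsetI)
      show "{w. w \<le> M \<and> S w x = 1} \<subseteq> {w. w \<le> M \<and> S w y = 1}"
        using that trans by blast
      show "{w. w \<le> M \<and> S w x = 1} \<noteq> {w. w \<le> M \<and> S w y = 1}"
        using that S_self[of x] by (auto simp: set_eq_iff intro!: exI[of _ x])
    qed
    then show ?thesis unfolding r_def by (intro psubset_card_mono fin)
  qed
  have rank: "S i j = (if r i < r j then 1 else - 1)" if "i \<le> M" "j \<le> M" "i \<noteq> j" for i j
    using sign[OF that] mono[of i j] mono[of j i] S_commute[of i j] that by auto
  have "inj_on r {..M}"
  proof (rule inj_onI, rule ccontr)
    fix i j assume "i \<in> {..M}" "j \<in> {..M}" "r i = r j" "i \<noteq> j"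
    then show False using sign[of i j] mono[of i j] mono[of j i] S_commute[of i j] by auto
  qed
  moreover have "r ` {..M} \<subseteq> {..M}"
  proof (clarsimp)
    fix x assume "x \<le> M"
    \<comment> \<open>No label is above itself, so at most \<open>M\<close> of the
      \<open>M + 1\<close> labels are counted.\<close>
    have "r x \<le> card ({..M} - {x})"
      unfolding r_def using S_self by (intro card_mono) auto
    then show "r x \<le> M" using \<open>x \<le> M\<close> by simp
  qed
  ultimately have "bij_betw r {..M} {..M}"
    by (simp add: bij_betw_def endo_inj_surj)
  moreover have "pattern_diff M s i j = (if r i < r j then 1 else - 1)" if "i < j" "j \<le> M" for i j
    using rank[of i j] S_less[OF that] that by simp
  ultimately show thesis by (rule that)
qed

text \<open>Decreasing, because \<open>r\<close> counts the labels above. For the identity this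
  means \<open>z 0 > ... > z M\<close>, with infinity last, which is the positive part.\<close>

definition ordered :: "nat \<Rightarrow> (nat \<Rightarrow> nat) \<Rightarrow> (nat \<Rightarrow> real) set" where
  "ordered M r = {z. \<forall>i\<le>M. \<forall>j\<le>M. r i < r j \<longrightarrow> z j < z i}"

lemma ordered_inj:
  assumes "z \<in> ordered M r" "inj_on r {..M}"
  shows "inj_on z {..M}"
proof (rule inj_onI, rule ccontr)
  fix i j assume ij: "i \<in> {..M}" "j \<in> {..M}" "z i = z j" "i \<noteq> j"
  then have "r i \<noteq> r j" using assms(2) by (auto simp: inj_on_def)
  then consider "r i < r j" | "r j < r i" by linarith
  then show False using assms(1) ij by cases (force simp: ordered_def)+
qed

lemma M0_signed_eq_ordered:
  assumes M: "1 \<le> M" and s: "s \<in> chords (Suc (Suc M)) \<rightarrow>\<^sub>E {1, -1}"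
    and inj: "inj_on r {..M}"
    and pat: "\<And>i j. i < j \<Longrightarrow> j \<le> M \<Longrightarrow> pattern_diff M s i j = (if r i < r j then 1 else - 1)"
  shows "M0_signed (Suc (Suc M)) s = affine_coords M ` ordered M r"
proof -
  have "(\<forall>i j. i < j \<longrightarrow> j \<le> M \<longrightarrow> sgn (z i - z j) = pattern_diff M s i j) \<longleftrightarrow> z \<in> ordered M r" for z
  proof
    assume z: "\<forall>i j. i < j \<longrightarrow> j \<le> M \<longrightarrow> sgn (z i - z j) = pattern_diff M s i j"
    have "z j < z i" if ij: "i \<le> M" "j \<le> M" "r i < r j" for i j
    proof (cases "i < j")
      case True
      then have "sgn (z i - z j) = 1" using z pat ij by simp
      then show ?thesis by (simp add: sgn_if split: if_splits)
    next
      case False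
      then have "j < i" using ij by (cases "i = j") auto
      then have "sgn (z j - z i) = - 1" using z pat ij by simp
      then show ?thesis by (simp add: sgn_if split: if_splits)
    qed
    then show "z \<in> ordered M r" by (simp add: ordered_def)
  next
    assume z: "z \<in> ordered M r"
    have "sgn (z i - z j) = pattern_diff M s i j" if ij: "i < j" "j \<le> M" for i j
    proof -
      have "r i \<noteq> r j" using inj ij by (auto simp: inj_on_def)
      then consider "r i < r j" | "r j < r i" by linarith
      then show ?thesis
      proof cases
        case 1
        then have "z j < z i" using z ij by (simp add: ordered_def)
        then show ?thesis using pat[OF ij] 1 by simp
      next
        case 2
        then have "z i < z j" using z ij by (simp add: ordered_def)
        then show ?thesis using pat[OF ij] 2 by simp
      qed
    qed
    then show "\<forall>i j. i < j \<longrightarrow> j \<le> M \<longrightarrow> sgn (z i - z j) = pattern_diff M s i j" by blast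
  qed
  then show ?thesis using M0_signed_eq[OF M s] by simp
qed

text \<open>Lets every result on signed parts apply to both sides of the isomorphism.\<close>

lemma M0_pos_eq_signed: "M0_pos n = M0_signed n (\<lambda>c\<in>chords n. 1)"
  by (auto simp: M0_pos_def M0_signed_def orthant_def dihedral_map_def M0_def sgn_1_pos)

lemma M0_pos_eq_ordered:
  assumes "1 \<le> M"
  shows "M0_pos (Suc (Suc M)) = affine_coords M ` ordered M (\<lambda>i. i)"
  unfolding M0_pos_eq_signed
proof (rule M0_signed_eq_ordered[OF assms])
  fix i j :: nat assume "i < j" "j \<le> M"
  then show "pattern_diff M (\<lambda>c\<in>chords (Suc (Suc M)). 1) i j = (if i < j then 1 else - 1)"
    by (simp add: pattern_diff_def doubleton_in_chords_iff)
qed auto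

section \<open>Semi-algebraic and topological structure\<close>

text \<open>Numerator and denominator are kept apart because an equation for a coordinate becomes
  polynomial only once the denominator is cleared.\<close>

definition ratio_num :: "nat \<Rightarrow> (nat \<Rightarrow> real) \<Rightarrow> nat set \<Rightarrow> real" where
  "ratio_num M z c = (let b = skew M (\<lambda>i j. z i - z j); i = Min c; j = Max c; n = Suc (Suc M) in
     b i ((j + 1) mod n) * b ((i + 1) mod n) j)"

definition ratio_den :: "nat \<Rightarrow> (nat \<Rightarrow> real) \<Rightarrow> nat set \<Rightarrow> real" where
  "ratio_den M z c = (let b = skew M (\<lambda>i j. z i - z j); i = Min c; j = Max c; n = Suc (Suc M) in
     b i j * b ((i + 1) mod n) ((j + 1) mod n))"

lemma affine_coords_eq_quotient:
  "c \<in> chords (Suc (Suc M)) \<Longrightarrow> affine_coords M z c = ratio_num M z c / ratio_den M z c"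
  by (simp add: affine_coords_def ratio_coords_def cyc_ratio_def ratio_num_def ratio_den_def Let_def)

lemma affine_coords_extensional: "affine_coords M z \<in> chords (Suc (Suc M)) \<rightarrow>\<^sub>E UNIV"
  by (simp add: affine_coords_def ratio_coords_extensional)

lemma ratio_den_nonzero:
  assumes z: "inj_on z {..M}" and c: "c \<in> chords (Suc (Suc M))"
  shows "ratio_den M z c \<noteq> 0"
proof -
  let ?n = "Suc (Suc M)" and ?i = "Min c" and ?j = "Max c"
  have nz: "skew M (\<lambda>i j. z i - z j) i j \<noteq> 0" if "i < ?n" "j < ?n" "i \<noteq> j" for i j
    using that z by (intro skew_nonzero) (auto simp: inj_on_def)
  have ij: "?i < ?n" "?j < ?n" using Min_Max_chord[OF c] .
  have "?i \<noteq> ?j" using c by (auto simp: chords_def min_def max_def split: if_splits)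
  moreover from this have "(?i + 1) mod ?n \<noteq> (?j + 1) mod ?n"
    using ij by (auto simp: mod_Suc)
  ultimately show ?thesis
    using ij nz[of ?i ?j] nz[of "(?i + 1) mod ?n" "(?j + 1) mod ?n"]
    by (simp add: ratio_den_def Let_def)
qed

lemma eq_affine_coords_iff:
  assumes "inj_on z {..M}" "v \<in> chords (Suc (Suc M)) \<rightarrow>\<^sub>E UNIV"
  shows "v = affine_coords M z \<longleftrightarrow> (\<forall>c\<in>chords (Suc (Suc M)). v c * ratio_den M z c = ratio_num M z c)"
proof -
  have "v = affine_coords M z \<longleftrightarrow> (\<forall>c\<in>chords (Suc (Suc M)). v c = affine_coords M z c)"
    using assms(2) affine_coords_extensional by (metis PiE_ext)
  then show ?thesis
    using ratio_den_nonzero[OF assms(1)] by (simp add: affine_coords_eq_quotient nonzero_eq_divide_eq)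
qed

text \<open>The affine representative normalised by \<open>z\<^sub>0 = 0\<close> and \<open>z\<^sub>M = 1\<close>.\<close>

definition norm_coord :: "nat \<Rightarrow> (nat set \<Rightarrow> real) \<Rightarrow> nat \<Rightarrow> real" where
  "norm_coord M u i = (if i = 0 then 0 else \<Prod>k\<in>{i..<M}. u {k, Suc M})"

text \<open>For \<open>i > 0\<close> the product is \<open>pattern_diff\<close> at the pair
  \<open>0\<close>, \<open>i\<close>. Label \<open>0\<close> has its own clause since
  \<open>{0, Suc M}\<close> is not a chord.\<close>

lemma norm_coord_affine_coords:
  assumes "inj_on z {..M}" "i \<le> M"
  shows "norm_coord M (affine_coords M z) i = (z 0 - z i) / (z 0 - z M)"
proof (cases "i = 0")
  case False
  have nz: "z i - z j \<noteq> 0" if "i < j" "j \<le> M" for i j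
    using assms(1) that by (auto simp: inj_on_def)
  have "z 0 - z i = (z 0 - z M) * pattern_diff M (affine_coords M z) 0 i"
    unfolding affine_coords_def
    using False assms(2) by (intro pattern_diff_ratio_coords nz) auto
  also have "pattern_diff M (affine_coords M z) 0 i = norm_coord M (affine_coords M z) i"
    using False by (simp add: pattern_diff_def norm_coord_def)
  finally show ?thesis using nz[of 0 M] False assms(2) by simp
qed (simp add: norm_coord_def)

text \<open>Permutes the finite labels and fixes infinity. Going through the normalised
  representative makes this a function of \<open>u\<close> alone, rational in
  \<open>u\<close>.\<close>

definition relabel :: "nat \<Rightarrow> (nat \<Rightarrow> nat) \<Rightarrow> (nat set \<Rightarrow> real) \<Rightarrow> nat set \<Rightarrow> real" where
  "relabel M p u = affine_coords M (\<lambda>i. norm_coord M u (p i))"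

lemma relabel_affine_coords:
  assumes M: "1 \<le> M" and z: "inj_on z {..M}" and p: "p ` {..M} \<subseteq> {..M}"
  shows "relabel M p (affine_coords M z) = affine_coords M (\<lambda>i. z (p i))"
proof -
  let ?k = "- 1 / (z 0 - z M)"
  have "z 0 \<noteq> z M" using z M by (auto simp: inj_on_def)
  have "relabel M p (affine_coords M z) = affine_coords M (\<lambda>i. ?k * z (p i) + z 0 / (z 0 - z M))"
    unfolding relabel_def
  proof (rule affine_coords_cong)
    fix i assume "i \<le> M"
    then have "p i \<le> M" using p by auto
    then have "norm_coord M (affine_coords M z) (p i) = (z 0 - z (p i)) / (z 0 - z M)"
      by (rule norm_coord_affine_coords[OF z])
    then show "norm_coord M (affine_coords M z) (p i) = ?k * z (p i) + z 0 / (z 0 - z M)"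
      by (simp add: diff_divide_distrib)
  qed
  also have "\<dots> = affine_coords M (\<lambda>i. z (p i))"
    using \<open>z 0 \<noteq> z M\<close> by (intro affine_coords_affine) simp
  finally show ?thesis .
qed

lemma inj_norm_coord:
  assumes "1 \<le> M" "inj_on z {..M}"
  shows "inj_on (norm_coord M (affine_coords M z)) {..M}"
proof (rule inj_onI)
  fix i j assume ij: "i \<in> {..M}" "j \<in> {..M}"
    "norm_coord M (affine_coords M z) i = norm_coord M (affine_coords M z) j"
  have "z 0 \<noteq> z M" using assms by (auto simp: inj_on_def)
  then have "z i = z j" using ij assms by (simp add: norm_coord_affine_coords)
  then show "i = j" using ij assms by (auto simp: inj_on_def)
qed

text \<open>Normalising a representative does not change its coordinates, so the only candidate to
  test is \<open>norm_coord M u\<close>. This eliminates the quantifier over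
  \<open>z\<close>.\<close>

lemma image_affine_coords_iff:
  assumes "1 \<le> M" "u \<in> chords (Suc (Suc M)) \<rightarrow>\<^sub>E UNIV"
  shows "(\<exists>z. u = affine_coords M z \<and> inj_on z {..M}) \<longleftrightarrow>
    (\<forall>i\<in>{..M}. \<forall>j\<in>{..M} - {i}. norm_coord M u i \<noteq> norm_coord M u j) \<and>
    (\<forall>c\<in>chords (Suc (Suc M)). u c * ratio_den M (norm_coord M u) c = ratio_num M (norm_coord M u) c)"
proof -
  have "(\<exists>z. u = affine_coords M z \<and> inj_on z {..M}) \<longleftrightarrow>
    inj_on (norm_coord M u) {..M} \<and> u = affine_coords M (norm_coord M u)"
  proof
    assume "\<exists>z. u = affine_coords M z \<and> inj_on z {..M}"
    then obtain z where z: "u = affine_coords M z" "inj_on z {..M}" by blast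
    have "relabel M (\<lambda>i. i) u = u"
      using relabel_affine_coords[OF assms(1) z(2), of "\<lambda>i. i"] z(1) by simp
    then show "inj_on (norm_coord M u) {..M} \<and> u = affine_coords M (norm_coord M u)"
      using inj_norm_coord[OF assms(1) z(2)] z(1) by (simp add: relabel_def)
  qed blast
  also have "\<dots> \<longleftrightarrow> inj_on (norm_coord M u) {..M} \<and>
    (\<forall>c\<in>chords (Suc (Suc M)). u c * ratio_den M (norm_coord M u) c = ratio_num M (norm_coord M u) c)"
    using eq_affine_coords_iff[OF _ assms(2)] by blast
  also have "inj_on (norm_coord M u) {..M} \<longleftrightarrow>
    (\<forall>i\<in>{..M}. \<forall>j\<in>{..M} - {i}. norm_coord M u i \<noteq> norm_coord M u j)"
    by (auto simp: inj_on_def)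
  finally show ?thesis .
qed

section \<open>Polynomial functions and closure properties of semi-algebraic sets\<close>

lemma poly_funs_uminus: "p \<in> poly_funs I \<Longrightarrow> (\<lambda>x. - p x) \<in> poly_funs I"
  using poly_funs.mult[OF poly_funs.const[of "- 1"]] by simp

lemma poly_funs_diff: "p \<in> poly_funs I \<Longrightarrow> q \<in> poly_funs I \<Longrightarrow> (\<lambda>x. p x - q x) \<in> poly_funs I"
  using poly_funs.add[OF _ poly_funs_uminus] by simp

lemma poly_funs_prod:
  "(\<And>k. k \<in> A \<Longrightarrow> p k \<in> poly_funs I) \<Longrightarrow> (\<lambda>x. \<Prod>k\<in>A. p k x) \<in> poly_funs I"
  by (induction A rule: infinite_finite_induct) (auto intro: poly_funs.intros)

lemma continuous_map_poly_funs:
  "p \<in> poly_funs I \<Longrightarrow> continuous_map (powertop_real I) euclideanreal p"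
  by (induction rule: poly_funs.induct) (auto intro: continuous_intros)

lemma semialgebraic_conj:
  assumes "{x \<in> I \<rightarrow>\<^sub>E UNIV. P x} \<in> semialgebraic_sets I" "{x \<in> I \<rightarrow>\<^sub>E UNIV. Q x} \<in> semialgebraic_sets I"
  shows "{x \<in> I \<rightarrow>\<^sub>E UNIV. P x \<and> Q x} \<in> semialgebraic_sets I"
proof -
  have "{x \<in> I \<rightarrow>\<^sub>E UNIV. P x \<and> Q x} = {x \<in> I \<rightarrow>\<^sub>E UNIV. P x} \<inter> {x \<in> I \<rightarrow>\<^sub>E UNIV. Q x}" by blast
  then show ?thesis using semialgebraic_sets.inter[OF assms] by simp
qed

lemma semialgebraic_not:
  assumes "{x \<in> I \<rightarrow>\<^sub>E UNIV. P x} \<in> semialgebraic_sets I"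
  shows "{x \<in> I \<rightarrow>\<^sub>E UNIV. \<not> P x} \<in> semialgebraic_sets I"
proof -
  have "{x \<in> I \<rightarrow>\<^sub>E UNIV. \<not> P x} = (I \<rightarrow>\<^sub>E UNIV) - {x \<in> I \<rightarrow>\<^sub>E UNIV. P x}" by blast
  then show ?thesis using semialgebraic_sets.compl[OF assms] by simp
qed

lemma semialgebraic_eq:
  assumes "p \<in> poly_funs I" "q \<in> poly_funs I"
  shows "{x \<in> I \<rightarrow>\<^sub>E UNIV. p x = q x} \<in> semialgebraic_sets I"
proof -
  have "{x \<in> I \<rightarrow>\<^sub>E UNIV. \<not> 0 < p x - q x \<and> \<not> 0 < q x - p x} \<in> semialgebraic_sets I"
    using assms by (intro semialgebraic_conj semialgebraic_not semialgebraic_sets.pos poly_funs_diff)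
  moreover have "(\<not> 0 < p x - q x \<and> \<not> 0 < q x - p x) = (p x = q x)" for x by auto
  ultimately show ?thesis by simp
qed

lemma semialgebraic_ball:
  assumes "finite A" "\<And>a. a \<in> A \<Longrightarrow> {x \<in> I \<rightarrow>\<^sub>E UNIV. P a x} \<in> semialgebraic_sets I"
  shows "{x \<in> I \<rightarrow>\<^sub>E UNIV. \<forall>a\<in>A. P a x} \<in> semialgebraic_sets I"
  using assms
proof (induction A rule: finite_induct)
  case empty
  show ?case
    using semialgebraic_sets.pos[OF poly_funs.const[of 1]] by simp
next
  case (insert a A)
  have "{x \<in> I \<rightarrow>\<^sub>E UNIV. P a x \<and> (\<forall>a\<in>A. P a x)} \<in> semialgebraic_sets I"
    using insert by (intro semialgebraic_conj) auto
  then show ?case by simp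
qed

lemma poly_funs_skew_diff:
  assumes "\<And>i. i \<le> M \<Longrightarrow> (\<lambda>x. f x i) \<in> poly_funs I" "i < Suc (Suc M)" "j < Suc (Suc M)"
  shows "(\<lambda>x. skew M (\<lambda>i j. f x i - f x j) i j) \<in> poly_funs I"
proof -
  consider "i \<le> M" "j \<le> M" | "i = Suc M" | "j = Suc M" using assms(2,3) by linarith
  then show ?thesis
  proof cases
    case 1
    then show ?thesis using assms(1) by (simp add: skew_diff poly_funs_diff)
  next
    case 2
    then show ?thesis by (cases "j = Suc M") (simp_all add: skew_def poly_funs.const)
  next
    case 3
    then show ?thesis by (cases "i = Suc M") (simp_all add: skew_def poly_funs.const)
  qed
qed

lemma poly_funs_ratio:
  assumes "\<And>i. i \<le> M \<Longrightarrow> (\<lambda>x. f x i) \<in> poly_funs I" "c \<in> chords (Suc (Suc M))"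
  shows "(\<lambda>x. ratio_num M (f x) c) \<in> poly_funs I" "(\<lambda>x. ratio_den M (f x) c) \<in> poly_funs I"
  unfolding ratio_num_def ratio_den_def Let_def
  using Min_Max_chord[OF assms(2)]
  by (intro poly_funs.mult poly_funs_skew_diff assms(1); simp)+

lemma poly_funs_norm_coord:
  assumes "\<And>c. c \<in> chords (Suc (Suc M)) \<Longrightarrow> e c \<in> I" "i \<le> M"
  shows "(\<lambda>x. norm_coord M (\<lambda>c. x (e c)) i) \<in> poly_funs I"
proof (cases "i = 0")
  case False
  then show ?thesis
    unfolding norm_coord_def using assms
    by (auto intro!: poly_funs_prod poly_funs.coord simp: doubleton_in_chords_iff)
qed (simp add: norm_coord_def poly_funs.const)

section \<open>Polynomial conditions for the signed parts\<close>

lemma M0_signed_iff: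
  assumes "1 \<le> M" and s: "s \<in> chords (Suc (Suc M)) \<rightarrow>\<^sub>E {1, -1}"
  shows "u \<in> M0_signed (Suc (Suc M)) s \<longleftrightarrow> u \<in> chords (Suc (Suc M)) \<rightarrow>\<^sub>E UNIV \<and>
    ((\<forall>i\<in>{..M}. \<forall>j\<in>{..M} - {i}. norm_coord M u i \<noteq> norm_coord M u j) \<and>
     (\<forall>c\<in>chords (Suc (Suc M)). u c * ratio_den M (norm_coord M u) c = ratio_num M (norm_coord M u) c) \<and>
     (\<forall>c\<in>chords (Suc (Suc M)). 0 < s c * u c))"
proof -
  \<comment> \<open>As \<open>s c\<close> is \<open>1\<close> or \<open>-1\<close>, the sign
    condition is a strict polynomial inequality, the form of the generating sets.\<close>
  have "sgn (u c) = s c \<longleftrightarrow> 0 < s c * u c" if "c \<in> chords (Suc (Suc M))" for c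
  proof -
    have "s c = 1 \<or> s c = - 1" using s that by (auto simp: PiE_iff)
    then show ?thesis by (elim disjE) (simp_all add: sgn_1_pos sgn_1_neg)
  qed
  then have "u \<in> M0_signed (Suc (Suc M)) s \<longleftrightarrow> u \<in> chords (Suc (Suc M)) \<rightarrow>\<^sub>E UNIV \<and>
    (\<exists>z. u = affine_coords M z \<and> inj_on z {..M}) \<and> (\<forall>c\<in>chords (Suc (Suc M)). 0 < s c * u c)"
    by (auto simp: M0_signed_def image_dihedral_map orthant_def)
  then show ?thesis using image_affine_coords_iff[OF assms(1), of u] by blast
qed

text \<open>The embedding \<open>e\<close> is the identity for the set itself and \<open>Inl\<close> for a graph over it.\<close>

lemma semialgebraic_M0_signed_conditions:
  fixes I :: "'i set"
  assumes e: "\<And>c. c \<in> chords (Suc (Suc M)) \<Longrightarrow> e c \<in> I"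
  shows "{x \<in> I \<rightarrow>\<^sub>E UNIV.
    (\<forall>i\<in>{..M}. \<forall>j\<in>{..M} - {i}. norm_coord M (\<lambda>c. x (e c)) i \<noteq> norm_coord M (\<lambda>c. x (e c)) j) \<and>
    (\<forall>c\<in>chords (Suc (Suc M)). x (e c) * ratio_den M (norm_coord M (\<lambda>c. x (e c))) c =
       ratio_num M (norm_coord M (\<lambda>c. x (e c))) c) \<and>
    (\<forall>c\<in>chords (Suc (Suc M)). 0 < s c * x (e c))} \<in> semialgebraic_sets I"
proof (intro semialgebraic_conj semialgebraic_ball finite_chords)
  fix i j assume "i \<in> {..M}" "j \<in> {..M} - {i}"
  then show "{x \<in> I \<rightarrow>\<^sub>E UNIV. norm_coord M (\<lambda>c. x (e c)) i \<noteq> norm_coord M (\<lambda>c. x (e c)) j}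
      \<in> semialgebraic_sets I"
    by (intro semialgebraic_not semialgebraic_eq poly_funs_norm_coord e) auto
next
  fix c assume c: "c \<in> chords (Suc (Suc M))"
  show "{x \<in> I \<rightarrow>\<^sub>E UNIV. x (e c) * ratio_den M (norm_coord M (\<lambda>c. x (e c))) c =
       ratio_num M (norm_coord M (\<lambda>c. x (e c))) c} \<in> semialgebraic_sets I"
    by (intro semialgebraic_eq poly_funs.mult poly_funs.coord poly_funs_ratio poly_funs_norm_coord e c)
next
  fix c assume c: "c \<in> chords (Suc (Suc M))"
  show "{x \<in> I \<rightarrow>\<^sub>E UNIV. 0 < s c * x (e c)} \<in> semialgebraic_sets I"
    by (intro semialgebraic_sets.pos poly_funs.mult poly_funs.const poly_funs.coord e c)
qed auto

lemma semialgebraic_M0_signed: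
  assumes "1 \<le> M" "s \<in> chords (Suc (Suc M)) \<rightarrow>\<^sub>E {1, -1}"
  shows "M0_signed (Suc (Suc M)) s \<in> semialgebraic_sets (chords (Suc (Suc M)))"
proof -
  have "M0_signed (Suc (Suc M)) s = {x \<in> chords (Suc (Suc M)) \<rightarrow>\<^sub>E UNIV. x \<in> M0_signed (Suc (Suc M)) s}"
    using M0_signed_iff[OF assms] by blast
  also have "\<dots> \<in> semialgebraic_sets (chords (Suc (Suc M)))"
    using semialgebraic_M0_signed_conditions[of M "\<lambda>c. c" "chords (Suc (Suc M))" s]
    by (simp add: M0_signed_iff[OF assms] cong: conj_cong)
  finally show ?thesis .
qed

lemma M0_signed_representative:
  assumes "u \<in> M0_signed (Suc (Suc M)) s"
  obtains z where "u = affine_coords M z" "inj_on z {..M}"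
  using assms by (auto simp: M0_signed_def image_dihedral_map)

lemma inj_on_norm_coord_permuted:
  assumes "1 \<le> M" "u \<in> M0_signed (Suc (Suc M)) s" "bij_betw p {..M} {..M}"
  shows "inj_on (\<lambda>i. norm_coord M u (p i)) {..M}"
proof -
  obtain z where "u = affine_coords M z" "inj_on z {..M}"
    using M0_signed_representative[OF assms(2)] .
  then have "inj_on (norm_coord M u) (p ` {..M})"
    using inj_norm_coord assms by (simp add: bij_betw_def)
  then have "inj_on (norm_coord M u \<circ> p) {..M}"
    using assms(3) by (intro comp_inj_on) (auto simp: bij_betw_def)
  then show ?thesis by (simp add: comp_def)
qed

section \<open>Relabelling as a semi-algebraic homeomorphism\<close>

lemma continuous_map_relabel:
  assumes M: "1 \<le> M" and p: "bij_betw p {..M} {..M}"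
  shows "continuous_map (subtopology (powertop_real (chords (Suc (Suc M)))) (M0_signed (Suc (Suc M)) s))
    (powertop_real (chords (Suc (Suc M)))) (relabel M p)"
  unfolding continuous_map_componentwise
proof (intro conjI ballI)
  show "relabel M p ` topspace (subtopology (powertop_real (chords (Suc (Suc M))))
      (M0_signed (Suc (Suc M)) s)) \<subseteq> extensional (chords (Suc (Suc M)))"
    using affine_coords_extensional by (fastforce simp: relabel_def PiE_def)
next
  fix c assume c: "c \<in> chords (Suc (Suc M))"
  let ?X = "subtopology (powertop_real (chords (Suc (Suc M)))) (M0_signed (Suc (Suc M)) s)"
  have le: "p i \<le> M" if "i \<le> M" for i using p that by (auto simp: bij_betw_def)
  have poly: "(\<lambda>u. norm_coord M u (p i)) \<in> poly_funs (chords (Suc (Suc M)))" if "i \<le> M" for i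
    using poly_funs_norm_coord[of M "\<lambda>c. c"] le that by simp
  have "continuous_map ?X euclideanreal
    (\<lambda>u. ratio_num M (\<lambda>i. norm_coord M u (p i)) c / ratio_den M (\<lambda>i. norm_coord M u (p i)) c)"
  proof (intro continuous_map_real_divide continuous_map_from_subtopology continuous_map_poly_funs
      poly_funs_ratio poly c)
    fix u assume "u \<in> topspace ?X"
    then show "ratio_den M (\<lambda>i. norm_coord M u (p i)) c \<noteq> 0"
      using inj_on_norm_coord_permuted[OF M _ p] by (intro ratio_den_nonzero c) auto
  qed
  then show "continuous_map ?X euclideanreal (\<lambda>u. relabel M p u c)"
    using c by (simp add: relabel_def affine_coords_eq_quotient)
qed

lemma semialgebraic_map_relabel:
  assumes M: "1 \<le> M" and s: "s \<in> chords (Suc (Suc M)) \<rightarrow>\<^sub>E {1, -1}"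
    and p: "bij_betw p {..M} {..M}"
  shows "semialgebraic_map (chords (Suc (Suc M))) (chords (Suc (Suc M)))
    (M0_signed (Suc (Suc M)) s) (relabel M p)"
proof -
  let ?I = "chords (Suc (Suc M))" and ?S = "M0_signed (Suc (Suc M)) s"
  define P where "P u \<longleftrightarrow>
    (\<forall>i\<in>{..M}. \<forall>j\<in>{..M} - {i}. norm_coord M u i \<noteq> norm_coord M u j) \<and>
     (\<forall>c\<in>?I. u c * ratio_den M (norm_coord M u) c = ratio_num M (norm_coord M u) c) \<and>
     (\<forall>c\<in>?I. 0 < s c * u c)" for u
  have P: "u \<in> ?S \<longleftrightarrow> u \<in> ?I \<rightarrow>\<^sub>E UNIV \<and> P u" for u
    unfolding P_def by (rule M0_signed_iff[OF M s])
  \<comment> \<open>The equation \<open>v = relabel M p u\<close> with denominators cleared, hence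
    polynomial in the pair of \<open>u\<close> and \<open>v\<close>.\<close>
  define Q where "Q u v \<longleftrightarrow> (\<forall>c\<in>?I. v c * ratio_den M (\<lambda>i. norm_coord M u (p i)) c =
    ratio_num M (\<lambda>i. norm_coord M u (p i)) c)" for u v
  have Q: "v = relabel M p u \<longleftrightarrow> Q u v" if "u \<in> ?S" "v \<in> ?I \<rightarrow>\<^sub>E UNIV" for u v
    unfolding relabel_def Q_def
    by (rule eq_affine_coords_iff[OF inj_on_norm_coord_permuted[OF M that(1) p] that(2)])
  have le: "p i \<le> M" if "i \<le> M" for i using p that by (auto simp: bij_betw_def)
  have ext: "relabel M p u \<in> ?I \<rightarrow>\<^sub>E UNIV" for u
    by (simp add: relabel_def affine_coords_extensional)
  have "(\<lambda>x. case_sum x (relabel M p x)) ` ?S =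
    {w \<in> (?I <+> ?I) \<rightarrow>\<^sub>E UNIV. P (\<lambda>c. w (Inl c)) \<and> Q (\<lambda>c. w (Inl c)) (\<lambda>c. w (Inr c))}" (is "?L = ?R")
  proof
    show "?L \<subseteq> ?R"
    proof clarify
      fix u assume u: "u \<in> ?S"
      have "case_sum u (relabel M p u) \<in> (?I <+> ?I) \<rightarrow>\<^sub>E UNIV"
        using u ext[of u] by (auto simp: P PiE_iff extensional_def split: sum.split)
      moreover have "Q u (relabel M p u)" using Q[OF u ext[of u]] by simp
      ultimately show "case_sum u (relabel M p u) \<in> (?I <+> ?I) \<rightarrow>\<^sub>E UNIV \<and>
        P (\<lambda>c. case_sum u (relabel M p u) (Inl c)) \<and>
        Q (\<lambda>c. case_sum u (relabel M p u) (Inl c)) (\<lambda>c. case_sum u (relabel M p u) (Inr c))"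
        using u P by simp
    qed
    show "?R \<subseteq> ?L"
    proof
      fix w assume "w \<in> ?R"
      then have w: "w \<in> (?I <+> ?I) \<rightarrow>\<^sub>E UNIV" "P (\<lambda>c. w (Inl c))" "Q (\<lambda>c. w (Inl c)) (\<lambda>c. w (Inr c))"
        by auto
      have "(\<lambda>c. w (Inl c)) \<in> ?I \<rightarrow>\<^sub>E UNIV" "(\<lambda>c. w (Inr c)) \<in> ?I \<rightarrow>\<^sub>E UNIV"
        using w(1) by (auto simp: PiE_iff extensional_def)
      then have "(\<lambda>c. w (Inl c)) \<in> ?S" "(\<lambda>c. w (Inr c)) = relabel M p (\<lambda>c. w (Inl c))"
        using w P Q by blast+
      moreover have "w = case_sum (\<lambda>c. w (Inl c)) (\<lambda>c. w (Inr c))"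
        by (auto split: sum.split)
      ultimately show "w \<in> ?L" by (metis (no_types, lifting) image_eqI)
    qed
  qed
  also have "\<dots> \<in> semialgebraic_sets (?I <+> ?I)"
  proof (rule semialgebraic_conj)
    show "{w \<in> (?I <+> ?I) \<rightarrow>\<^sub>E UNIV. P (\<lambda>c. w (Inl c))} \<in> semialgebraic_sets (?I <+> ?I)"
      unfolding P_def by (rule semialgebraic_M0_signed_conditions) blast
    show "{w \<in> (?I <+> ?I) \<rightarrow>\<^sub>E UNIV. Q (\<lambda>c. w (Inl c)) (\<lambda>c. w (Inr c))}
        \<in> semialgebraic_sets (?I <+> ?I)"
      unfolding Q_def
      by (intro semialgebraic_ball finite_chords semialgebraic_eq poly_funs.mult poly_funs.coord
          poly_funs_ratio poly_funs_norm_coord le InlI InrI)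
  qed
  finally show ?thesis
    using ext by (auto simp: semialgebraic_map_def)
qed

text \<open>If \<open>z\<close> is ranked by \<open>r\<close>, then \<open>z\<close> after
  \<open>p\<close> is ranked by \<open>r\<close> after \<open>p\<close>. It serves with
  \<open>p\<close> the inverse of the ranking, to sort, and with \<open>p\<close> the ranking
  itself, to undo the sorting.\<close>

lemma relabel_image:
  assumes M: "1 \<le> M" and r: "inj_on r {..M}" and p: "p ` {..M} \<subseteq> {..M}"
    and q: "\<And>i. i \<le> M \<Longrightarrow> r (p i) = q i"
  shows "relabel M p ` affine_coords M ` ordered M r \<subseteq> affine_coords M ` ordered M q"
proof clarify
  fix z assume z: "z \<in> ordered M r"
  have "relabel M p (affine_coords M z) = affine_coords M (\<lambda>i. z (p i))"
    using relabel_affine_coords[OF M ordered_inj[OF z r] p] .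
  moreover have "(\<lambda>i. z (p i)) \<in> ordered M q"
    using z p q by (auto simp: ordered_def image_subset_iff)
  ultimately show "relabel M p (affine_coords M z) \<in> affine_coords M ` ordered M q" by simp
qed

lemma relabel_relabel:
  assumes M: "1 \<le> M" and r: "inj_on r {..M}" and p: "bij_betw p {..M} {..M}"
    and q: "q ` {..M} \<subseteq> {..M}" "\<And>i. i \<le> M \<Longrightarrow> p (q i) = i"
    and u: "u \<in> affine_coords M ` ordered M r"
  shows "relabel M q (relabel M p u) = u"
proof -
  obtain z where z: "u = affine_coords M z" "inj_on z {..M}"
    using u ordered_inj[OF _ r] by blast
  have p': "p ` {..M} \<subseteq> {..M}" using p by (simp add: bij_betw_def)
  have "inj_on (\<lambda>i. z (p i)) {..M}"
    using comp_inj_on[of p "{..M}" z] p z(2) by (simp add: bij_betw_def comp_def)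
  then have "relabel M q (relabel M p u) = affine_coords M (\<lambda>i. z (p (q i)))"
    using relabel_affine_coords[OF M z(2) p'] relabel_affine_coords[OF M _ q(1)] z(1) by simp
  also have "\<dots> = u" unfolding z(1) by (rule affine_coords_cong) (simp add: q(2))
  finally show ?thesis .
qed

lemma isomorphic_M0_pos:
  assumes M: "1 \<le> M" and s: "s \<in> chords (Suc (Suc M)) \<rightarrow>\<^sub>E {1, -1}"
    and r: "bij_betw r {..M} {..M}"
    and S: "M0_signed (Suc (Suc M)) s = affine_coords M ` ordered M r"
  shows "semialgebraic_isomorphic (chords (Suc (Suc M))) (chords (Suc (Suc M)))
    (M0_signed (Suc (Suc M)) s) (M0_pos (Suc (Suc M)))"
proof -
  let ?n = "Suc (Suc M)"
  let ?S = "M0_signed ?n s" and ?T = "M0_pos ?n"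
  let ?X = "subtopology (powertop_real (chords ?n)) ?S"
  let ?Y = "subtopology (powertop_real (chords ?n)) ?T"
  \<comment> \<open>\<open>p i\<close> is the label of rank \<open>i\<close>, so relabelling by
    \<open>p\<close> lists the points in decreasing order.\<close>
  define p where "p = inv_into {..M} r"
  have p: "bij_betw p {..M} {..M}" unfolding p_def by (rule bij_betw_inv_into[OF r])
  have rp: "r (p i) = i" "p (r i) = i" if "i \<le> M" for i
    using that r by (auto simp: p_def bij_betw_inv_into_right bij_betw_inv_into_left)
  have into: "r ` {..M} \<subseteq> {..M}" "p ` {..M} \<subseteq> {..M}" and inj: "inj_on r {..M}"
    using r p by (auto simp: bij_betw_def)
  have one: "(\<lambda>c\<in>chords ?n. 1) \<in> chords ?n \<rightarrow>\<^sub>E {1, - 1 :: real}" by auto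
  have T: "?T = affine_coords M ` ordered M (\<lambda>i. i)" by (rule M0_pos_eq_ordered[OF M])
  have "relabel M p ` ?S \<subseteq> ?T"
    unfolding S T using rp by (intro relabel_image[OF M inj into(2)])
  moreover have "relabel M r ` ?T \<subseteq> ?S"
    unfolding S T by (rule relabel_image[OF M _ into(1)]) auto
  moreover have "continuous_map ?X (powertop_real (chords ?n)) (relabel M p)"
    by (rule continuous_map_relabel[OF M p])
  moreover have "continuous_map ?Y (powertop_real (chords ?n)) (relabel M r)"
    unfolding M0_pos_eq_signed by (rule continuous_map_relabel[OF M r])
  moreover have "relabel M r (relabel M p u) = u" if "u \<in> ?S" for u
    using that rp(1,2) unfolding S by (intro relabel_relabel[OF M inj p into(1)])
  moreover have "relabel M p (relabel M r u) = u" if "u \<in> ?T" for u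
    using that rp unfolding T by (intro relabel_relabel[OF M _ r into(2)]) auto
  ultimately have "homeomorphic_maps ?X ?Y (relabel M p) (relabel M r)"
    unfolding homeomorphic_maps_def continuous_map_in_subtopology by (auto simp: image_subset_iff)
  then have "homeomorphic_map ?X ?Y (relabel M p)" by (rule homeomorphic_maps_imp_map)
  moreover have "semialgebraic_map (chords ?n) (chords ?n) ?S (relabel M p)"
    by (rule semialgebraic_map_relabel[OF M s p])
  moreover have "?S \<in> semialgebraic_sets (chords ?n)" "?T \<in> semialgebraic_sets (chords ?n)"
    unfolding M0_pos_eq_signed using semialgebraic_M0_signed[OF M] s one by blast+
  ultimately show ?thesis unfolding semialgebraic_isomorphic_def by blast
qed

section \<open>Connectedness of the signed parts\<close>

lemma connectedin_image_ordered:
  assumes inj: "inj_on r {..M}"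
  shows "connectedin (powertop_real (chords (Suc (Suc M)))) (affine_coords M ` ordered M r)"
proof (rule path_connectedin_imp_connectedin)
  let ?X = "powertop_real (chords (Suc (Suc M)))"
  show "path_connectedin ?X (affine_coords M ` ordered M r)"
    unfolding path_connectedin
  proof (intro conjI ballI)
    show "affine_coords M ` ordered M r \<subseteq> topspace ?X"
      using affine_coords_extensional by auto
  next
    fix u v assume "u \<in> affine_coords M ` ordered M r" "v \<in> affine_coords M ` ordered M r"
    then obtain y z where yz: "u = affine_coords M y" "v = affine_coords M z"
      "y \<in> ordered M r" "z \<in> ordered M r" by blast
    \<comment> \<open>The segment from \<open>y\<close> to \<open>z\<close> stays in
      \<open>ordered M r\<close>, whose conditions are strict linear inequalities. Entries thus
      remain distinct along it and no denominator vanishes.\<close>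
    define f where "f t i = (1 - t) * y i + t * z i" for t i
    have f: "f t \<in> ordered M r" if t: "t \<in> {0..1}" for t
      unfolding ordered_def
    proof (intro CollectI allI impI)
      fix i j assume "i \<le> M" "j \<le> M" "r i < r j"
      then have "y j < y i" "z j < z i" using yz by (auto simp: ordered_def)
      then have "(1 - t) * (y i - y j) + t * (z i - z j) > 0"
        using t by (cases "t = 0") (auto intro: add_nonneg_pos)
      then show "f t j < f t i" by (simp add: f_def algebra_simps)
    qed
    have cont: "continuous_on {0..1} (\<lambda>t. skew M (\<lambda>i j. f t i - f t j) i j)" for i j
      by (cases "i = j"; cases "j = Suc M"; cases "i = Suc M"; cases "i < j")
        (auto simp: skew_def f_def intro!: continuous_intros)
    have "pathin ?X (\<lambda>t. affine_coords M (f t))"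
      unfolding pathin_def continuous_map_componentwise
    proof (intro conjI ballI)
      show "(\<lambda>t. affine_coords M (f t)) ` topspace (top_of_set {0..1}) \<subseteq> extensional (chords (Suc (Suc M)))"
        using affine_coords_extensional by (fastforce simp: PiE_def)
      fix c assume c: "c \<in> chords (Suc (Suc M))"
      have "continuous_on {0..1} (\<lambda>t. ratio_num M (f t) c / ratio_den M (f t) c)"
      proof (rule continuous_on_divide)
        show "continuous_on {0..1} (\<lambda>t. ratio_num M (f t) c)" "continuous_on {0..1} (\<lambda>t. ratio_den M (f t) c)"
          unfolding ratio_num_def ratio_den_def Let_def by (intro continuous_on_mult cont)+
        show "\<forall>t\<in>{0..1}. ratio_den M (f t) c \<noteq> 0"
          using ratio_den_nonzero[OF ordered_inj[OF f inj] c] by blast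
      qed
      then show "continuous_map (top_of_set {0..1}) euclideanreal (\<lambda>t. affine_coords M (f t) c)"
        using c by (simp add: affine_coords_eq_quotient)
    qed
    moreover have "(\<lambda>t. affine_coords M (f t)) \<in> {0..1} \<rightarrow> affine_coords M ` ordered M r"
      using f by blast
    moreover have "affine_coords M (f 0) = u" "affine_coords M (f 1) = v"
      by (simp_all add: f_def[abs_def] yz)
    ultimately show "\<exists>g. pathin ?X g \<and> g \<in> {0..1} \<rightarrow> affine_coords M ` ordered M r \<and> g 0 = u \<and> g 1 = v"
      by blast
  qed
qed

theorem theorem1p4:
  fixes n :: nat and s :: "nat set \<Rightarrow> real"
  assumes "n \<ge> 3"
    and "s \<in> chords n \<rightarrow>\<^sub>E {1, -1}"
  shows "(M0_signed n s \<noteq> {} \<longleftrightarrow> consistent n s) \<and>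
    (consistent n s \<longrightarrow> realizable n s) \<and>
    (M0_signed n s \<noteq> {} \<longrightarrow>
       connectedin (powertop_real (chords n)) (M0_signed n s) \<and>
       semialgebraic_isomorphic (chords n) (chords n) (M0_signed n s) (M0_pos n))"
proof -
  \<comment> \<open>Labels \<open>0\<close> to \<open>M\<close> are finite and \<open>Suc M\<close>
    is infinity. From \<open>n >= 3\<close> the labels \<open>0\<close> and \<open>M\<close> differ,
    as the normalisation requires.\<close>
  obtain M where n: "n = Suc (Suc M)" and M: "1 \<le> M"
  proof
    show "n = Suc (Suc (n - 2))" "1 \<le> n - 2" using assms(1) by auto
  qed
  note s = assms(2)[unfolded n]
  have main: "M0_signed n s \<noteq> {} \<and> connectedin (powertop_real (chords n)) (M0_signed n s) \<and>
    semialgebraic_isomorphic (chords n) (chords n) (M0_signed n s) (M0_pos n)" if con: "consistent n s"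
  proof -
    obtain r where r: "bij_betw r {..M} {..M}"
      "\<And>i j. i < j \<Longrightarrow> j \<le> M \<Longrightarrow> pattern_diff M s i j = (if r i < r j then 1 else - 1)"
      using consistent_obtains_ranking[OF con[unfolded n] s] by blast
    have inj: "inj_on r {..M}" using r(1) by (rule bij_betw_imp_inj_on)
    have S: "M0_signed n s = affine_coords M ` ordered M r"
      unfolding n by (rule M0_signed_eq_ordered[OF M s inj r(2)])
    \<comment> \<open>Negated ranks give an explicit realization.\<close>
    have "(\<lambda>i. - real (r i)) \<in> ordered M r" by (simp add: ordered_def)
    then have "M0_signed n s \<noteq> {}" unfolding S by blast
    moreover have "connectedin (powertop_real (chords n)) (M0_signed n s)"
      unfolding S unfolding n by (rule connectedin_image_ordered[OF inj])
    moreover have "semialgebraic_isomorphic (chords n) (chords n) (M0_signed n s) (M0_pos n)"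
      unfolding n by (rule isomorphic_M0_pos[OF M s r(1) S[unfolded n]])
    ultimately show ?thesis by blast
  qed
  moreover have "consistent n s" if "M0_signed n s \<noteq> {}"
    using consistent_if_M0_signed_nonempty that n by blast
  ultimately show ?thesis unfolding realizable_def by blast
qed

end
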